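(* Let $\sigma>0$ and let $\nu,\mu\in\mathbb{T}$ with $\nu^2=\mu^2=-1$. For all $\varphi=\varphi^+e_++\varphi^-e_-$ and $\psi=\psi^+e_++\psi^-e_-$ in $L^2_{\mathbb{T}}(\mathbb{R}^2)$ (with $\varphi^\pm,\psi^\pm\in L^2_{\mathbb{C}}(\mathbb{R}^2)$) and all $Z=z_1+jz_2\in\mathbb{T}$ with $z_\ell=x_\ell+iy_\ell$, $X=(x_1,x_2)$, $Y=(y_1,y_2)$, $$\mathcal{V}^{\sigma,\nu,\mu}_{\mathbb{R}^2,\mathbb{T}}(\varphi,\psi)(Z)=\mathcal{V}^{\sigma,\nu}_{\mathbb{R}^2,\mathbb{C}^2}(\varphi^+,\psi^+)(X,Y)\,e_++\mathcal{V}^{\sigma,\mu}_{\mathbb{R}^2,\mathbb{C}^2}(\varphi^-,\psi^-)(X,Y)\,e_- .$$ Moreover, for all $\varphi_1,\varphi_2,\psi_1,\psi_2\in L^2_{\mathbb{T}}(\mathbb{R}^2)=L^2_{\mathbb{T}}(\mathbb{C})$, $$\left\langle\mathcal{V}^{\sigma,\nu,\mu}_{\mathbb{R}^2,\mathbb{T}}(\varphi_1,\psi_1),\mathcal{V}^{\sigma,\nu,\mu}_{\mathbb{R}^2,\mathbb{T}}(\varphi_2,\psi_2)\right\rangle_{L^2_{\mathbb{T}}(\mathbb{T})}=\langle\varphi_1,\varphi_2\rangle_{L^2_{\mathbb{T}}(\mathbb{C})}\,\langle\psi_1,\psi_2\rangle_{L^2_{\mathbb{T}}(\mathbb{C})}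 .$$
   Context: Bicomplex numbers: $\mathbb{T}=\{Z=z_1+jz_2:\ z_1,z_2\in\mathbb{C}\}$ with $i^2=j^2=-1$, $ij=ji$. The idempotents $e_\pm=\frac{1\pm ij}{2}$ satisfy $e_\pm^2=e_\pm$, $e_+e_-=0$, $e_++e_-=1$; every bicomplex number is uniquely $ae_++be_-$ with $a,b\in\mathbb{C}$. Conjugation: $(ae_++be_-)^*=\bar a e_++\bar b e_-$. Exponentials are computed componentwise. Function spaces: $L^2_{\mathbb{T}}(X)$ is the space of functions $f=f^+e_++f^-e_-$ with $f^\pm\in L^2_{\mathbb{C}}(X)$, with $\mathbb{T}$-valued inner product $\langle f,g\rangle=\int_X f g^*\,d\lambda$; here $X=\mathbb{R}^2\cong\mathbb{C}$ or $X=\mathbb{T}\cong\mathbb{C}^2\cong\mathbb{R}^4$ (via $Z=z_1+jz_2\mapsto(z_1,z_2)$) with Lebesgue measure. Imaginary units: $\nu,\mu\in\mathbb{T}$ with $\nu^2=\mu^2=-1$ (each is one of $\pm i,\pm j$). There are signs with $\nu e_+=\pm ie_+$, $\mu e_-=\pm ie_-$; inside the $e_+$ (resp. $e_-$) component, $\nu$ (resp. $\mu$) is identified with the corresponding $\pm i\in\mathbb{C}$. Complex transform (the rescaled Fourier--Wigner transform in dimension $d=2$, whose prefactor is $(\sigma/2\pi)^{d/2}$): for $f,g\in L^2_{\mathbb{C}}(\mathbb{R}^2)$, $X,Y\in\mathbb{R}^2$, $\tau\in\{\nu,\mu\}$, $$\mathcal{V}^{\sigma,\tau}_{\mathbb{R}^2,\mathbb{C}^2}(f,g)(X,Y)=\frac{\sigma}{2\pi}\int_{\mathbb{R}^2}e^{\tau\sigma\langle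 U-\frac X2,Y\rangle_{\mathbb{R}^2}}f(U)\overline{g(U-X)}\,d\lambda(U).$$ Bidimensional bicomplex Fourier--Wigner transform: for $\varphi,\psi\in L^2_{\mathbb{T}}(\mathbb{R}^2)$ and $Z,X,Y$ as in the claim, $$\mathcal{V}^{\sigma,\nu,\mu}_{\mathbb{R}^2,\mathbb{T}}(\varphi,\psi)(Z)=\left(\frac{1}{2\pi}\right)^{1/2}\int_{\mathbb{R}^2}e^{\sigma(\nu e_++\mu e_-)\langle U-\frac X2,Y\rangle_{\mathbb{R}^2}}\varphi(U)\,\psi^*(U-X)\,d\lambda(U),\qquad \psi^*(U):=(\psi(U))^*.$$
   Formalization: The bicomplex transform has prefactor σ/(2π) instead of (1/2π)^{1/2}, as the splitting requires, and the second identity has the conjugate ⟨ψ1,ψ2⟩* in place of ⟨ψ1,ψ2⟩; as printed both claims fail in general. *)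

theory Defs
  imports "HOL-Analysis.Analysis"
begin

section \<open>Bicomplex numbers\<close>

text \<open>
  \<open>Bicomplex z1 z2\<close> stands for \<open>z1 + j z2\<close>. The type is made a real Euclidean space by transporting
  the structure of \<open>\<complex>\<^sup>2 = \<real>\<^sup>4\<close>, so that \<open>lebesgue :: bicomplex measure\<close> is Lebesgue
  measure on \<open>\<real>\<^sup>4\<close> and the Bochner integral applies to bicomplex-valued functions.
\<close>

datatype bicomplex = Bicomplex (bc_fst: complex) (bc_snd: complex)

lemma bicomplex_eq_iff: "Z = W \<longleftrightarrow> bc_fst Z = bc_fst W \<and> bc_snd Z = bc_snd W"
  by (cases Z; cases W) simp

instantiation bicomplex :: comm_ring_1
begin

definition "0 = Bicomplex 0 0"
definition "1 = Bicomplex 1 0"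
definition "Z + W = Bicomplex (bc_fst Z + bc_fst W) (bc_snd Z + bc_snd W)"
definition "- Z = Bicomplex (- bc_fst Z) (- bc_snd Z)"
definition "Z - W = Bicomplex (bc_fst Z - bc_fst W) (bc_snd Z - bc_snd W)"
definition "Z * W = Bicomplex (bc_fst Z * bc_fst W - bc_snd Z * bc_snd W)
                              (bc_fst Z * bc_snd W + bc_snd Z * bc_fst W)"

instance
  by standard
    (simp_all add: bicomplex_eq_iff zero_bicomplex_def one_bicomplex_def plus_bicomplex_def
      uminus_bicomplex_def minus_bicomplex_def times_bicomplex_def algebra_simps)

end

lemma bc_sel_simps [simp]:
  "bc_fst 0 = 0" "bc_snd 0 = 0" "bc_fst 1 = 1" "bc_snd 1 = 0"
  "bc_fst (Z + W) = bc_fst Z + bc_fst W" "bc_snd (Z + W) = bc_snd Z + bc_snd W"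
  "bc_fst (- Z) = - bc_fst Z" "bc_snd (- Z) = - bc_snd Z"
  "bc_fst (Z - W) = bc_fst Z - bc_fst W" "bc_snd (Z - W) = bc_snd Z - bc_snd W"
  "bc_fst (Z * W) = bc_fst Z * bc_fst W - bc_snd Z * bc_snd W"
  "bc_snd (Z * W) = bc_fst Z * bc_snd W + bc_snd Z * bc_fst W"
  by (simp_all add: zero_bicomplex_def one_bicomplex_def plus_bicomplex_def
      uminus_bicomplex_def minus_bicomplex_def times_bicomplex_def)

instantiation bicomplex :: real_algebra_1
begin

definition "scaleR r Z = Bicomplex (r *\<^sub>R bc_fst Z) (r *\<^sub>R bc_snd Z)"

instance
  by standard (simp_all add: bicomplex_eq_iff scaleR_bicomplex_def algebra_simps)

end

lemma bc_sel_scaleR [simp]: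
  "bc_fst (r *\<^sub>R Z) = r *\<^sub>R bc_fst Z" "bc_snd (r *\<^sub>R Z) = r *\<^sub>R bc_snd Z"
  by (simp_all add: scaleR_bicomplex_def)

instantiation bicomplex :: real_inner
begin

definition inner_bicomplex :: "bicomplex \<Rightarrow> bicomplex \<Rightarrow> real" where
  "inner_bicomplex Z W = bc_fst Z \<bullet> bc_fst W + bc_snd Z \<bullet> bc_snd W"
definition norm_bicomplex :: "bicomplex \<Rightarrow> real" where
  "norm_bicomplex Z = sqrt (Z \<bullet> Z)"
definition sgn_bicomplex :: "bicomplex \<Rightarrow> bicomplex" where
  "sgn_bicomplex Z = inverse (norm Z) *\<^sub>R Z"
definition dist_bicomplex :: "bicomplex \<Rightarrow> bicomplex \<Rightarrow> real" where
  "dist_bicomplex Z W = norm (Z - W)"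
definition uniformity_bicomplex :: "(bicomplex \<times> bicomplex) filter" where
  "uniformity_bicomplex = (INF e\<in>{0<..}. principal {(Z, W). dist Z W < e})"
definition open_bicomplex :: "bicomplex set \<Rightarrow> bool" where
  "open_bicomplex U \<longleftrightarrow> (\<forall>Z\<in>U. eventually (\<lambda>(Z', W). Z' = Z \<longrightarrow> W \<in> U) uniformity)"

instance
proof
  fix Z W V :: bicomplex and r :: real and U :: "bicomplex set"
  show "dist Z W = norm (Z - W)" by (rule dist_bicomplex_def)
  show "sgn Z = inverse (norm Z) *\<^sub>R Z" by (rule sgn_bicomplex_def)
  show "uniformity = (INF e\<in>{0<..}. principal {(Z, W :: bicomplex). dist Z W < e})"
    by (rule uniformity_bicomplex_def)
  show "open U \<longleftrightarrow> (\<forall>Z\<in>U. \<forall>\<^sub>F (Z', W) in uniformity. Z' = Z \<longrightarrow> W \<in> U)"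
    by (rule open_bicomplex_def)
  show "Z \<bullet> W = W \<bullet> Z" by (simp add: inner_bicomplex_def inner_commute)
  show "(Z + W) \<bullet> V = Z \<bullet> V + W \<bullet> V" by (simp add: inner_bicomplex_def inner_add_left)
  show "(r *\<^sub>R Z) \<bullet> W = r * (Z \<bullet> W)" by (simp add: inner_bicomplex_def distrib_left)
  show "0 \<le> Z \<bullet> Z" by (simp add: inner_bicomplex_def)
  show "Z \<bullet> Z = 0 \<longleftrightarrow> Z = 0"
    by (simp add: inner_bicomplex_def bicomplex_eq_iff add_nonneg_eq_0_iff)
  show "norm Z = sqrt (Z \<bullet> Z)" by (rule norm_bicomplex_def)
qed

end

instantiation bicomplex :: euclidean_space
begin

definition Basis_bicomplex :: "bicomplex set" where
  "Basis_bicomplex = {Bicomplex 1 0, Bicomplex \<i> 0, Bicomplex 0 1, Bicomplex 0 \<i>}"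

instance
proof
  show "(Basis :: bicomplex set) \<noteq> {}" by (simp add: Basis_bicomplex_def)
  show "finite (Basis :: bicomplex set)" by (simp add: Basis_bicomplex_def)
  show "U \<bullet> V = (if U = V then 1 else 0)" if "U \<in> Basis" "V \<in> Basis" for U V :: bicomplex
    using that unfolding Basis_bicomplex_def inner_bicomplex_def inner_complex_def
    by (elim insertE emptyE) simp_all
  show "(\<forall>U\<in>Basis. Z \<bullet> U = 0) \<longleftrightarrow> Z = 0" for Z :: bicomplex
    by (cases Z) (auto simp: Basis_bicomplex_def inner_bicomplex_def inner_complex_def
        zero_bicomplex_def complex_eq_iff)
qed

end

definition bc_of_complex :: "complex \<Rightarrow> bicomplex" where
  "bc_of_complex a = Bicomplex a 0"

definition bc_i :: bicomplex where
  "bc_i = bc_of_complex \<i>"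

definition bc_j :: bicomplex where
  "bc_j = Bicomplex 0 1"

lemma bc_units: "bc_i * bc_i = -1" "bc_j * bc_j = -1"
  by (simp_all add: bc_i_def bc_j_def bc_of_complex_def bicomplex_eq_iff)

lemma Bicomplex_eq: "Bicomplex z1 z2 = bc_of_complex z1 + bc_j * bc_of_complex z2"
  by (simp add: bc_j_def bc_of_complex_def bicomplex_eq_iff)

definition e_plus :: bicomplex where
  "e_plus = (1/2) *\<^sub>R (1 + bc_i * bc_j)"

definition e_minus :: bicomplex where
  "e_minus = (1/2) *\<^sub>R (1 - bc_i * bc_j)"

lemma idempotents:
  "e_plus * e_plus = e_plus" "e_minus * e_minus = e_minus"
  "e_plus * e_minus = 0" "e_plus + e_minus = 1"
  by (simp_all add: e_plus_def e_minus_def bc_i_def bc_j_def bc_of_complex_def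
      bicomplex_eq_iff complex_eq_iff)

text \<open>
  The idempotent coordinates of \<open>Z = z1 + j z2\<close>. Since \<open>j e\<^sub>+ = - i e\<^sub>+\<close> and \<open>j e\<^sub>- = i e\<^sub>-\<close>,
  they are \<open>z1 - i z2\<close> and \<open>z1 + i z2\<close>; the lemma \<open>idem_unique\<close> shows that these are the
  unique complex \<open>a\<close> and \<open>b\<close> with \<open>Z = a e\<^sub>+ + b e\<^sub>-\<close>.
\<close>

definition idem_plus :: "bicomplex \<Rightarrow> complex" where
  "idem_plus Z = bc_fst Z - \<i> * bc_snd Z"

definition idem_minus :: "bicomplex \<Rightarrow> complex" where
  "idem_minus Z = bc_fst Z + \<i> * bc_snd Z"

definition of_idem :: "complex \<Rightarrow> complex \<Rightarrow> bicomplex" where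
  "of_idem a b = bc_of_complex a * e_plus + bc_of_complex b * e_minus"

lemma idem_unique: "Z = of_idem a b \<longleftrightarrow> a = idem_plus Z \<and> b = idem_minus Z"
proof -
  have "bc_fst (of_idem a b) = (a + b) / 2" "bc_snd (of_idem a b) = \<i> * (a - b) / 2"
    by (simp_all add: of_idem_def e_plus_def e_minus_def bc_i_def bc_j_def bc_of_complex_def
        complex_eq_iff add_divide_distrib diff_divide_distrib)
  moreover have "z = (a + b) / 2 \<and> w = \<i> * (a - b) / 2 \<longleftrightarrow> a = z - \<i> * w \<and> b = z + \<i> * w"
    for z w :: complex
    by (auto simp: complex_eq_iff)
  ultimately show ?thesis
    unfolding bicomplex_eq_iff idem_plus_def idem_minus_def by metis
qed

definition bc_conj :: "bicomplex \<Rightarrow> bicomplex" where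
  "bc_conj Z = of_idem (cnj (idem_plus Z)) (cnj (idem_minus Z))"

definition bc_exp :: "bicomplex \<Rightarrow> bicomplex" where
  "bc_exp Z = of_idem (exp (idem_plus Z)) (exp (idem_minus Z))"


section \<open>Square-integrable functions\<close>

text \<open>
  Elements of the \<open>L\<^sup>2\<close> spaces are represented by Lebesgue measurable functions; no passage to
  almost-everywhere classes is made.
\<close>

definition L2C :: "('a::euclidean_space \<Rightarrow> complex) set" where
  "L2C = {f. f \<in> borel_measurable lebesgue \<and> integrable lebesgue (\<lambda>x. (cmod (f x))\<^sup>2)}"

definition L2T :: "('a::euclidean_space \<Rightarrow> bicomplex) set" where
  "L2T = {f. (\<lambda>x. idem_plus (f x)) \<in> L2C \<and> (\<lambda>x. idem_minus (f x)) \<in> L2C}"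

definition L2T_inner :: "('a::euclidean_space \<Rightarrow> bicomplex) \<Rightarrow> ('a \<Rightarrow> bicomplex) \<Rightarrow> bicomplex" where
  "L2T_inner f g = (\<integral>x. f x * bc_conj (g x) \<partial>lebesgue)"


section \<open>Fourier--Wigner transforms\<close>

text \<open>
  The parameter \<open>\<tau>\<close> is a complex number: a bicomplex imaginary unit acts on the \<open>e\<^sub>+\<close>
  (\<open>e\<^sub>-\<close>) component through its coordinate \<open>idem_plus\<close> (\<open>idem_minus\<close>), which is \<open>i\<close> or \<open>-i\<close>.
\<close>

definition fourier_wigner_C ::
  "real \<Rightarrow> complex \<Rightarrow> (real^2 \<Rightarrow> complex) \<Rightarrow> (real^2 \<Rightarrow> complex) \<Rightarrow> real^2 \<Rightarrow> real^2 \<Rightarrow> complex"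
where
  "fourier_wigner_C \<sigma> \<tau> f g X Y =
     of_real (\<sigma> / (2 * pi)) *
     (\<integral>U. exp (\<tau> * of_real (\<sigma> * ((U - X /\<^sub>R 2) \<bullet> Y))) * f U * cnj (g (U - X)) \<partial>lebesgue)"

text \<open>
  For \<open>Z = z1 + j z2\<close> with \<open>z1 = x1 + i y1\<close> and \<open>z2 = x2 + i y2\<close>: \<open>X = (x1, x2)\<close>, \<open>Y = (y1, y2)\<close>.
\<close>

definition bc_X :: "bicomplex \<Rightarrow> real^2" where
  "bc_X Z = vector [Re (bc_fst Z), Re (bc_snd Z)]"

definition bc_Y :: "bicomplex \<Rightarrow> real^2" where
  "bc_Y Z = vector [Im (bc_fst Z), Im (bc_snd Z)]"

text \<open>
  The normalising factor is \<open>(\<sigma> / 2 \<pi>)\<^bsup>d/2\<^esup>\<close> with \<open>d = 2\<close>, as for the complex transform. With the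
  factor \<open>(1 / 2 \<pi>)\<^bsup>1/2\<^esup>\<close> that is sometimes printed, neither the splitting into complex
  transforms nor the Moyal identity holds, except for \<open>\<sigma> = sqrt (2 \<pi>)\<close>.
\<close>

definition fourier_wigner_T ::
  "real \<Rightarrow> bicomplex \<Rightarrow> bicomplex \<Rightarrow> (real^2 \<Rightarrow> bicomplex) \<Rightarrow> (real^2 \<Rightarrow> bicomplex)
    \<Rightarrow> bicomplex \<Rightarrow> bicomplex"
where
  "fourier_wigner_T \<sigma> \<nu> \<mu> \<phi> \<psi> Z =
     (\<sigma> / (2 * pi)) *\<^sub>R
     (\<integral>U. bc_exp ((\<sigma> * ((U - bc_X Z /\<^sub>R 2) \<bullet> bc_Y Z)) *\<^sub>R (\<nu> * e_plus + \<mu> * e_minus))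
           * \<phi> U * bc_conj (\<psi> (U - bc_X Z)) \<partial>lebesgue)"

end

theory Submission
  imports Defs "HOL-Probability.Characteristic_Functions"
begin

text \<open>
  Idempotent coordinates turn every statement into two complex ones, so the heart of the matter is
  the Moyal identity for the complex transform. For fixed \<open>X\<close> the transform is, up to a unimodular
  factor that is the same for all windows, the Fourier transform of
  \<open>U \<mapsto> f U * cnj (g (U - X))\<close>. This function is integrable for every \<open>X\<close> and square integrable
  for almost every \<open>X\<close>, so Plancherel's theorem on \<open>L\<^sup>1 \<inter> L\<^sup>2\<close> in the variable \<open>Y\<close> and Fubini in
  \<open>(X, U)\<close> give the identity. Plancherel's theorem holds because \<open>|fourier h|\<^sup>2\<close> is the Fourier
  transform of the autocorrelation of \<open>h\<close>, which is integrable, bounded and continuous at \<open>0\<close>: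
  integrate against widening Gaussians and pass to the limit.
\<close>

section \<open>Affine substitutions and translations in \<open>L\<^sup>1\<close>\<close>

text \<open>Plancherel's identity is first obtained for norms only: the integrability of
  \<open>|fourier h|^2\<close> is not known in advance, and monotone convergence, which yields it
  together with the integral, needs nonnegative integrands. Inner products then follow by
  polarization. Since the windowed product may fail to be square integrable for exceptional X, the
  formulas for the integrals over Y hold only for almost every X, and Fubini in (X, Y) has to be
  prepared by showing that the transform is square integrable on the product space. A second
  obstacle is measurability: members of \<open>L2C\<close> are Lebesgue measurable, whereas the
  product-measure arguments work with Borel functions. The complex transform is therefore computed
  with Borel representatives, which leaves its value unchanged at every point (X, Y). Constants:
  with frequency \<kappa> = \<sigma> or \<kappa> = -\<sigma>, the unnormalised transform contributes
  (2 pi)^2 from Plancherel and 1 / \<sigma>^2 from the substitution of \<kappa> Y for Y, which is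
  exactly the inverse of the squared prefactor \<sigma> / (2 pi).\<close>

lemma
  fixes f :: "'a::euclidean_space \<Rightarrow> 'b::{banach, second_countable_topology}"
  assumes c: "c \<noteq> 0" and [measurable]: "f \<in> borel_measurable borel"
  shows integral_lborel_affine:
      "(\<integral>x. f (t + c *\<^sub>R x) \<partial>lborel) = inverse (\<bar>c\<bar> ^ DIM('a)) *\<^sub>R (\<integral>x. f x \<partial>lborel)"
    and integrable_lborel_affine_iff:
      "integrable lborel (\<lambda>x. f (t + c *\<^sub>R x)) \<longleftrightarrow> integrable lborel f"
proof -
  have "(\<integral>x. f x \<partial>lborel) = \<bar>c\<bar> ^ DIM('a) *\<^sub>R (\<integral>x. f (t + c *\<^sub>R x) \<partial>lborel)"
    by (subst lborel_affine[OF c, of t]) (simp add: integral_density integral_distr)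
  then show "(\<integral>x. f (t + c *\<^sub>R x) \<partial>lborel) = inverse (\<bar>c\<bar> ^ DIM('a)) *\<^sub>R (\<integral>x. f x \<partial>lborel)"
    using c by simp
  have scale: "integrable lborel (\<lambda>x. k *\<^sub>R g x) \<longleftrightarrow> integrable lborel g" if "k \<noteq> 0"
    for k and g :: "'a \<Rightarrow> 'b"
    using integrable_scaleR_right[of k lborel g]
      integrable_scaleR_right[of "inverse k" lborel "\<lambda>x. k *\<^sub>R g x"] that by auto
  show "integrable lborel (\<lambda>x. f (t + c *\<^sub>R x)) \<longleftrightarrow> integrable lborel f"
    using c by (subst (2) lborel_affine[OF c, of t])
      (simp add: integrable_density integrable_distr_eq scale)
qed

lemma
  fixes f :: "'a::euclidean_space \<Rightarrow> 'b::{banach, second_countable_topology}"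
  assumes [measurable]: "f \<in> borel_measurable borel"
  shows integral_lborel_translate: "(\<integral>x. f (x - t) \<partial>lborel) = (\<integral>x. f x \<partial>lborel)"
    and integrable_lborel_translate_iff: "integrable lborel (\<lambda>x. f (x - t)) \<longleftrightarrow> integrable lborel f"
    and integral_lborel_reflect: "(\<integral>x. f (t - x) \<partial>lborel) = (\<integral>x. f x \<partial>lborel)"
    and integrable_lborel_reflect_iff: "integrable lborel (\<lambda>x. f (t - x)) \<longleftrightarrow> integrable lborel f"
  using integral_lborel_affine[of 1 f "-t"] integrable_lborel_affine_iff[of 1 f "-t"]
    integral_lborel_affine[of "-1" f t] integrable_lborel_affine_iff[of "-1" f t] by simp_all

text \<open>Continuity of translation in the L1 norm along one fixed sequence of shifts. The
  sequential form is the one that dominated convergence can use.\<close>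

definition translation_tendsto :: "(nat \<Rightarrow> 'a::euclidean_space) \<Rightarrow> ('a \<Rightarrow> 'b::{banach, second_countable_topology}) \<Rightarrow> bool"
  where "translation_tendsto t f \<longleftrightarrow> (\<lambda>n. \<integral>x. norm (f (x - t n) - f x) \<partial>lborel) \<longlonglongrightarrow> 0"

text \<open>A three-epsilon argument: \<open>f\<close> and its approximant \<open>g\<close> are
  equally close before and after the shift, by translation invariance of the integral. Hence the
  property is closed under L1 limits.\<close>

lemma translation_tendsto_approx:
  fixes f :: "'a::euclidean_space \<Rightarrow> 'b::{banach, second_countable_topology}"
  assumes f: "integrable lborel f"
    and ex: "\<And>e. e > 0 \<Longrightarrow> \<exists>g. integrable lborel g \<and> translation_tendsto t g \<and> (\<integral>x. norm (f x - g x) \<partial>lborel) \<le> e"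
  shows "translation_tendsto t f"
  unfolding translation_tendsto_def
proof (rule LIMSEQ_I)
  fix r :: real assume "r > 0"
  then obtain g where g: "integrable lborel g" "translation_tendsto t g"
    and le: "(\<integral>x. norm (f x - g x) \<partial>lborel) \<le> r / 3"
    using ex[of "r / 3"] by auto
  have [measurable]: "f \<in> borel_measurable borel" "g \<in> borel_measurable borel"
    using f g by (auto dest: borel_measurable_integrable)
  obtain N where N: "\<And>n. n \<ge> N \<Longrightarrow> norm ((\<integral>x. norm (g (x - t n) - g x) \<partial>lborel) - 0) < r / 3"
    using LIMSEQ_D[OF g(2)[unfolded translation_tendsto_def], of "r / 3"] \<open>r > 0\<close> by auto
  have "norm ((\<integral>x. norm (f (x - t n) - f x) \<partial>lborel) - 0) < r" if "n \<ge> N" for n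
  proof -
    have i: "integrable lborel (\<lambda>x. f (x - t n))" "integrable lborel (\<lambda>x. g (x - t n))"
      using f g by (simp_all add: integrable_lborel_translate_iff)
    have "(\<integral>x. norm (f (x - t n) - f x) \<partial>lborel)
        \<le> (\<integral>x. norm (f (x - t n) - g (x - t n)) + norm (g (x - t n) - g x) + norm (f x - g x) \<partial>lborel)"
    proof (rule integral_mono)
      fix x
      have "f (x - t n) - f x = (f (x - t n) - g (x - t n)) + (g (x - t n) - g x) - (f x - g x)" by simp
      then show "norm (f (x - t n) - f x) \<le> norm (f (x - t n) - g (x - t n)) + norm (g (x - t n) - g x) + norm (f x - g x)"
        using norm_triangle_ineq4[of "(f (x - t n) - g (x - t n)) + (g (x - t n) - g x)" "f x - g x"]
          norm_triangle_ineq[of "f (x - t n) - g (x - t n)" "g (x - t n) - g x"] by simp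
    qed (use i f g in auto)
    also have "\<dots> = (\<integral>x. norm (f (x - t n) - g (x - t n)) \<partial>lborel)
        + (\<integral>x. norm (g (x - t n) - g x) \<partial>lborel) + (\<integral>x. norm (f x - g x) \<partial>lborel)"
      using i f g by simp
    also have "(\<integral>x. norm (f (x - t n) - g (x - t n)) \<partial>lborel) = (\<integral>x. norm (f x - g x) \<partial>lborel)"
      by (rule integral_lborel_translate) measurable
    also have "\<dots> + (\<integral>x. norm (g (x - t n) - g x) \<partial>lborel) + (\<integral>x. norm (f x - g x) \<partial>lborel) < r"
      using N[OF that] le by simp
    finally show ?thesis by simp
  qed
  then show "\<exists>no. \<forall>n\<ge>no. norm ((\<integral>x. norm (f (x - t n) - f x) \<partial>lborel) - 0) < r" by blast
qed

text \<open>Openness gives pointwise convergence of the shifted indicators on \<open>U\<close>, but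
  nothing is known on its boundary. Multiplying by \<open>indicator U\<close> removes the bad points
  and provides the dominating function. The L1 distance is recovered from this product, because the
  indicators of two sets A and B satisfy |1_A - 1_B| = 1_A + 1_B - 2 1_A 1_B and both sets have the
  same measure here.\<close>

lemma translation_tendsto_open:
  fixes U :: "'a::euclidean_space set" and c :: "'b::{banach, second_countable_topology}"
  assumes t: "t \<longlonglongrightarrow> 0" and U: "open U" "emeasure lborel U < \<infinity>"
  shows "translation_tendsto t (\<lambda>x. indicator U x *\<^sub>R c)"
proof -
  have [measurable]: "U \<in> sets borel" using U by simp
  have iU: "integrable lborel (indicator U :: 'a \<Rightarrow> real)" using U by simp
  have iU': "integrable lborel (\<lambda>x. indicator U (x - t n) :: real)" for n
    using iU by (subst integrable_lborel_translate_iff) auto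
  have "(\<lambda>n. \<integral>x. indicator U (x - t n) * indicator U x \<partial>lborel) \<longlonglongrightarrow> (\<integral>x. indicator U x \<partial>lborel :: real)"
  proof (rule integral_dominated_convergence[where w="indicator U"])
    show "AE x in lborel. (\<lambda>n. indicator U (x - t n) * indicator U x :: real) \<longlonglongrightarrow> indicator U x"
    proof (rule AE_I2)
      fix x
      show "(\<lambda>n. indicator U (x - t n) * indicator U x :: real) \<longlonglongrightarrow> indicator U x"
      proof (cases "x \<in> U")
        case True
        have "(\<lambda>n. x - t n) \<longlonglongrightarrow> x" using tendsto_diff[OF tendsto_const t, of x] by simp
        then have "\<forall>\<^sub>F n in sequentially. x - t n \<in> U"
          using U True by (simp add: topological_tendstoD)
        then show ?thesis
          using True by (intro tendsto_eventually) (auto elim!: eventually_mono)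
      qed simp
    qed
  qed (use iU in \<open>auto simp: indicator_def\<close>)
  then have "(\<lambda>n. 2 * ((\<integral>x. indicator U x \<partial>lborel) - (\<integral>x. indicator U (x - t n) * indicator U x \<partial>lborel)) * norm c) \<longlonglongrightarrow>
     2 * ((\<integral>x. indicator U x \<partial>lborel :: real) - (\<integral>x. indicator U x \<partial>lborel)) * norm c"
    by (intro tendsto_intros)
  moreover have "(\<integral>x. norm (indicator U (x - t n) *\<^sub>R c - indicator U x *\<^sub>R c) \<partial>lborel)
     = 2 * ((\<integral>x. indicator U x \<partial>lborel) - (\<integral>x. indicator U (x - t n) * indicator U x \<partial>lborel)) * norm c" for n
  proof -
    have ii: "integrable lborel (\<lambda>x. indicator U (x - t n) * indicator U x :: real)"
      by (rule Bochner_Integration.integrable_bound[OF iU]) (auto simp: indicator_def)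
    have "(\<integral>x. norm (indicator U (x - t n) *\<^sub>R c - indicator U x *\<^sub>R c) \<partial>lborel)
       = (\<integral>x. (indicator U (x - t n) + indicator U x - 2 * (indicator U (x - t n) * indicator U x)) * norm c \<partial>lborel)"
      by (rule Bochner_Integration.integral_cong) (auto simp: indicator_def)
    also have "\<dots> = (\<integral>x. (indicator U (x - t n) + indicator U x - 2 * (indicator U (x - t n) * indicator U x)) \<partial>lborel) * norm c"
      by simp
    also have "(\<integral>x. (indicator U (x - t n) + indicator U x - 2 * (indicator U (x - t n) * indicator U x :: real)) \<partial>lborel)
       = (\<integral>x. indicator U (x - t n) \<partial>lborel) + (\<integral>x. indicator U x \<partial>lborel)
          - 2 * (\<integral>x. indicator U (x - t n) * indicator U x \<partial>lborel)"
      using iU iU'[of n] ii by simp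
    also have "(\<integral>x. indicator U (x - t n) \<partial>lborel) = (\<integral>x. (indicator U x :: real) \<partial>lborel)"
      by (rule integral_lborel_translate) simp
    finally show ?thesis by simp
  qed
  ultimately show ?thesis
    unfolding translation_tendsto_def by simp
qed

text \<open>Induction over integrable functions: indicators are approximated by indicators of open
  sets through outer regularity, sums use the triangle inequality, and limits use closedness in
  L1.\<close>

lemma integrable_translation_tendsto:
  fixes f :: "'a::euclidean_space \<Rightarrow> 'b::{banach, second_countable_topology}"
  assumes t: "t \<longlonglongrightarrow> 0" and f: "integrable lborel f"
  shows "translation_tendsto t f"
  using f
proof (induction rule: integrable_induct)
  case (base A c)
  then have A[measurable]: "A \<in> sets borel" by simp
  show ?case
  proof (rule translation_tendsto_approx)
    fix e :: real assume "e > 0"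
    \<comment> \<open>The summand 1 keeps \<open>d\<close> positive when
      \<open>c = 0\<close>.\<close>
    define d where "d = e / (norm c + 1)"
    have d: "d > 0" "d * norm c \<le> e"
      using \<open>e > 0\<close> by (auto simp: d_def field_simps add_pos_nonneg)
    obtain U where U: "open U" "A \<subseteq> U" "emeasure lborel (U - A) < d"
      using outer_regular_lborel[OF A d(1)] by blast
    have [measurable]: "U \<in> sets borel" using U by simp
    have "emeasure lborel U = emeasure lborel (U - A) + emeasure lborel A"
      using plus_emeasure[of "U - A" lborel A] U(2) by (simp add: Un_absorb2 Diff_Int_distrib2)
    moreover have "emeasure lborel (U - A) < \<infinity>"
      using less_trans[OF U(3) ennreal_less_top] by simp
    ultimately have fU: "emeasure lborel U < \<infinity>"
      using base by simp
    have "(\<integral>x. norm (indicator A x *\<^sub>R c - indicator U x *\<^sub>R c) \<partial>lborel) = (\<integral>x. indicator (U - A) x * norm c \<partial>lborel)"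
      using U(2) by (intro Bochner_Integration.integral_cong) (auto simp: indicator_def)
    also have "\<dots> = measure lborel (U - A) * norm c" by simp
    also have "\<dots> \<le> d * norm c"
      using U(3) d(1) by (intro mult_right_mono) (auto simp: measure_def intro!: enn2real_leI)
    finally show "\<exists>g. integrable lborel g \<and> translation_tendsto t g \<and> (\<integral>x. norm (indicator A x *\<^sub>R c - g x) \<partial>lborel) \<le> e"
      using translation_tendsto_open[OF t U(1) fU, of c] d(2) fU
      by (intro exI[of _ "\<lambda>x. indicator U x *\<^sub>R c"]) auto
  qed (use base in auto)
next
  case (add f g)
  have [measurable]: "f \<in> borel_measurable borel" "g \<in> borel_measurable borel"
    using add(1,2)[THEN borel_measurable_integrable] by simp_all
  show ?case
    unfolding translation_tendsto_def
  proof (rule tendsto_sandwich[OF _ _ tendsto_const])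
    show "\<forall>\<^sub>F n in sequentially. (\<integral>x. norm (f (x - t n) + g (x - t n) - (f x + g x)) \<partial>lborel)
       \<le> (\<integral>x. norm (f (x - t n) - f x) \<partial>lborel) + (\<integral>x. norm (g (x - t n) - g x) \<partial>lborel)"
    proof (intro always_eventually allI)
      fix n
      have i: "integrable lborel (\<lambda>x. f (x - t n) - f x)" "integrable lborel (\<lambda>x. g (x - t n) - g x)"
        using add(1,2) by (simp_all add: integrable_lborel_translate_iff)
      have "integrable lborel (\<lambda>x. (f (x - t n) - f x) + (g (x - t n) - g x))"
        by (intro Bochner_Integration.integrable_add i)
      then have "(\<integral>x. norm ((f (x - t n) - f x) + (g (x - t n) - g x)) \<partial>lborel)
        \<le> (\<integral>x. norm (f (x - t n) - f x) + norm (g (x - t n) - g x) \<partial>lborel)"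
        by (intro integral_mono Bochner_Integration.integrable_add integrable_norm i norm_triangle_ineq)
      also have "\<dots> = (\<integral>x. norm (f (x - t n) - f x) \<partial>lborel) + (\<integral>x. norm (g (x - t n) - g x) \<partial>lborel)"
        by (intro Bochner_Integration.integral_add integrable_norm i)
      finally show "(\<integral>x. norm (f (x - t n) + g (x - t n) - (f x + g x)) \<partial>lborel)
       \<le> (\<integral>x. norm (f (x - t n) - f x) \<partial>lborel) + (\<integral>x. norm (g (x - t n) - g x) \<partial>lborel)"
        by (simp add: algebra_simps)
    qed
    show "(\<lambda>n. (\<integral>x. norm (f (x - t n) - f x) \<partial>lborel) + (\<integral>x. norm (g (x - t n) - g x) \<partial>lborel)) \<longlonglongrightarrow> 0"
      using tendsto_add[OF add(3,4)[unfolded translation_tendsto_def]] by simp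
  qed (simp add: integral_nonneg_AE)
next
  case (lim f s)
  have [measurable]: "f \<in> borel_measurable borel" "\<And>i. s i \<in> borel_measurable borel"
    using lim(1,4)[THEN borel_measurable_integrable] by simp_all
  show ?case
  proof (rule translation_tendsto_approx[OF lim(4)])
    fix e :: real assume "e > 0"
    have "(\<lambda>i. \<integral>x. norm (f x - s i x) \<partial>lborel) \<longlonglongrightarrow> (\<integral>x. 0 \<partial>(lborel :: 'a measure))"
    \<comment> \<open>The approximants of the induction satisfy
      \<open>norm (s i x) \<le> 2 * norm (f x)\<close>, so their distance to \<open>f\<close> is at
      most three times \<open>norm (f x)\<close>.\<close>
    proof (rule integral_dominated_convergence[where w="\<lambda>x. 3 * norm (f x)"])
      show "AE x in lborel. (\<lambda>i. norm (f x - s i x)) \<longlonglongrightarrow> 0"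
      proof (rule AE_I2)
        fix x
        have "(\<lambda>i. f x - s i x) \<longlonglongrightarrow> f x - f x"
          using lim(2)[of x] by (intro tendsto_intros) simp
        then show "(\<lambda>i. norm (f x - s i x)) \<longlonglongrightarrow> 0" by (simp add: tendsto_norm_zero)
      qed
      show "AE x in lborel. norm (norm (f x - s i x)) \<le> 3 * norm (f x)" for i
      proof (rule AE_I2)
        fix x
        show "norm (norm (f x - s i x)) \<le> 3 * norm (f x)"
          using lim(3)[of x i] norm_triangle_ineq4[of "f x" "s i x"] by simp
      qed
      show "integrable lborel (\<lambda>x. 3 * norm (f x))"
        using lim(4) by simp
      show "(\<lambda>x. norm (f x - s i x)) \<in> borel_measurable lborel" for i
        by measurable
    qed simp
    then have "\<forall>\<^sub>F i in sequentially. (\<integral>x. norm (f x - s i x) \<partial>lborel) < e"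
      using order_tendstoD(2)[of _ 0 sequentially e] \<open>e > 0\<close> by simp
    then obtain i where "(\<integral>x. norm (f x - s i x) \<partial>lborel) < e"
      by (auto simp: eventually_sequentially)
    then show "\<exists>g. integrable lborel g \<and> translation_tendsto t g \<and> (\<integral>x. norm (f x - g x) \<partial>lborel) \<le> e"
      using lim(1)[of i] lim(5)[of i] by (intro exI[of _ "s i"]) simp
  qed
qed

section \<open>Square-integrable functions and autocorrelation\<close>

text \<open>The signed square \<open>a * \<bar>a\<bar>\<close> maps real L2 functions to L1
  functions without losing the sign, so this inequality bounds a squared L2 distance by an L1
  distance. For equal signs it follows from |a - b| \<le> |a + b|, even without the factor 2; for
  opposite signs from (a - b)^2 \<le> 2 (a^2 + b^2), where a = -b shows that 2 is needed.\<close>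

lemma norm_diff_sq_le_signed_sq:
  fixes a b :: real
  shows "(a - b)\<^sup>2 \<le> 2 * \<bar>a * \<bar>a\<bar> - b * \<bar>b\<bar>\<bar>"
proof -
  have *: "(a - b)\<^sup>2 \<le> 2 * \<bar>a * \<bar>a\<bar> - b * \<bar>b\<bar>\<bar>" if "b \<le> a" for a b :: real
  proof (cases "0 \<le> b")
    case True
    have "(a - b) * (a - b) \<le> (a - b) * (a + b)"
      using that True by (intro mult_left_mono) auto
    moreover have "(a - b) * (a + b) = a * \<bar>a\<bar> - b * \<bar>b\<bar>"
      using that True by (simp add: algebra_simps)
    moreover have "0 \<le> (a - b) * (a + b)"
      using that True by (intro mult_nonneg_nonneg) auto
    ultimately show ?thesis by (simp add: power2_eq_square)
  next
    case b: False
    show ?thesis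
    proof (cases "0 \<le> a")
      case True
      have "(a - b)\<^sup>2 \<le> 2 * (a * a + b * b)"
        using sum_squares_bound[of a "-b"] by (simp add: power2_eq_square algebra_simps)
      moreover have "a * \<bar>a\<bar> - b * \<bar>b\<bar> = a * a + b * b" "0 \<le> a * a + b * b" using b True by auto
      ultimately show ?thesis by simp
    next
      case False
      have "(a - b) * (a - b) \<le> (a - b) * - (a + b)"
        using that False b by (intro mult_left_mono) auto
      moreover have "(a - b) * - (a + b) = a * \<bar>a\<bar> - b * \<bar>b\<bar>"
        using that False b by (simp add: algebra_simps)
      moreover have "0 \<le> (a - b) * - (a + b)"
        using that False b by (intro mult_nonneg_nonneg) auto
      ultimately show ?thesis by (simp add: power2_eq_square)
    qed
  qed
  show ?thesis
    using *[of a b] *[of b a] by (cases "b \<le> a") (auto simp: power2_commute abs_minus_commute)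
qed

lemma borel_measurable_cnj [measurable (raw)]:
  "f \<in> borel_measurable M \<Longrightarrow> (\<lambda>x. cnj (f x)) \<in> borel_measurable M"
  by (rule borel_measurable_continuous_on) (intro continuous_intros)

text \<open>The condition of \<open>L2C\<close> over an arbitrary measure, so that it serves
  \<open>lborel\<close>, its product with itself and the completion alike.\<close>

definition square_integrable :: "'a measure \<Rightarrow> ('a \<Rightarrow> complex) \<Rightarrow> bool" where
  "square_integrable M f \<longleftrightarrow> f \<in> borel_measurable M \<and> integrable M (\<lambda>x. (cmod (f x))\<^sup>2)"

lemma square_integrable_measurable [measurable_dest]:
  "square_integrable M f \<Longrightarrow> f \<in> borel_measurable M"
  by (simp add: square_integrable_def)

lemma square_integrableD: "square_integrable M f \<Longrightarrow> integrable M (\<lambda>x. (cmod (f x))\<^sup>2)"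
  by (simp add: square_integrable_def)

lemma prod_le_mean_sq: "x * y \<le> (x\<^sup>2 + y\<^sup>2) / 2" for x y :: real
  using sum_squares_bound[of x y] by simp

lemma cmod_mult_le_sq: "cmod (a * b) \<le> ((cmod a)\<^sup>2 + (cmod b)\<^sup>2) / 2"
  by (simp add: norm_mult prod_le_mean_sq del: le_divide_eq_numeral1)

lemma square_integrable_mult_cnj:
  assumes "square_integrable M f" "square_integrable M g"
  shows "integrable M (\<lambda>x. f x * cnj (g x))"
proof (rule Bochner_Integration.integrable_bound)
  show "integrable M (\<lambda>x. ((cmod (f x))\<^sup>2 + (cmod (g x))\<^sup>2) / 2)"
    using assms by (auto dest!: square_integrableD)
  show "(\<lambda>x. f x * cnj (g x)) \<in> borel_measurable M"
    using assms[THEN square_integrable_measurable] by measurable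
  show "AE x in M. norm (f x * cnj (g x)) \<le> norm (((cmod (f x))\<^sup>2 + (cmod (g x))\<^sup>2) / 2)"
    using cmod_mult_le_sq[of "f x" "cnj (g x)" for x] by (intro AE_I2) simp
qed

lemma square_integrable_add_cmult:
  assumes "square_integrable M f" "square_integrable M g"
  shows "square_integrable M (\<lambda>x. f x + c * g x)"
  unfolding square_integrable_def
proof
  show m: "(\<lambda>x. f x + c * g x) \<in> borel_measurable M"
    using assms[THEN square_integrable_measurable] by measurable
  show "integrable M (\<lambda>x. (cmod (f x + c * g x))\<^sup>2)"
  proof (rule Bochner_Integration.integrable_bound)
    show "integrable M (\<lambda>x. 2 * (cmod (f x))\<^sup>2 + 2 * (cmod c)\<^sup>2 * (cmod (g x))\<^sup>2)"
      using assms by (auto dest!: square_integrableD)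
    show "AE x in M. norm ((cmod (f x + c * g x))\<^sup>2) \<le> norm (2 * (cmod (f x))\<^sup>2 + 2 * (cmod c)\<^sup>2 * (cmod (g x))\<^sup>2)"
    proof (rule AE_I2)
      fix x
      have "(cmod (f x + c * g x))\<^sup>2 \<le> (cmod (f x) + cmod c * cmod (g x))\<^sup>2"
        using norm_triangle_ineq[of "f x" "c * g x"] by (intro power_mono) (simp_all add: norm_mult)
      also have "\<dots> \<le> 2 * (cmod (f x))\<^sup>2 + 2 * (cmod c)\<^sup>2 * (cmod (g x))\<^sup>2"
        using sum_squares_bound[of "cmod (f x)" "cmod c * cmod (g x)"]
        by (simp add: power2_sum power_mult_distrib)
      finally show "norm ((cmod (f x + c * g x))\<^sup>2) \<le> norm (2 * (cmod (f x))\<^sup>2 + 2 * (cmod c)\<^sup>2 * (cmod (g x))\<^sup>2)"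
        by simp
    qed
  qed (use m in measurable)
qed

lemma square_integrable_translate:
  fixes h :: "'a::euclidean_space \<Rightarrow> complex"
  assumes h: "square_integrable lborel h"
  shows "square_integrable lborel (\<lambda>x. h (x - s))"
proof -
  have [measurable]: "h \<in> borel_measurable borel"
    using h by (simp add: square_integrable_def)
  show ?thesis
    using h integrable_lborel_translate_iff[of "\<lambda>x. (cmod (h x))\<^sup>2" s] by (simp add: square_integrable_def)
qed

text \<open>The signed squares of the real and imaginary parts are integrable, and their translations
  control the translation of \<open>h\<close> in \<open>L\<^sup>2\<close>.\<close>

lemma square_integrable_translation_tendsto:
  fixes h :: "'a::euclidean_space \<Rightarrow> complex"
  assumes t: "t \<longlonglongrightarrow> 0" and h: "square_integrable lborel h"
  shows "(\<lambda>n. \<integral>x. (cmod (h (x - t n) - h x))\<^sup>2 \<partial>lborel) \<longlonglongrightarrow> 0"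
proof -
  define a where "a = (\<lambda>x. Re (h x) * \<bar>Re (h x)\<bar>)"
  define b where "b = (\<lambda>x. Im (h x) * \<bar>Im (h x)\<bar>)"
  have [measurable]: "h \<in> borel_measurable borel"
    using h by (simp add: square_integrable_def)
  have [measurable]: "a \<in> borel_measurable borel" "b \<in> borel_measurable borel"
    unfolding a_def b_def by measurable
  have sq: "\<bar>r * \<bar>r\<bar>\<bar> = r\<^sup>2" for r :: real
    by (simp add: abs_mult power2_eq_square)
  have "\<bar>a x\<bar> \<le> (cmod (h x))\<^sup>2" "\<bar>b x\<bar> \<le> (cmod (h x))\<^sup>2" for x
    unfolding a_def b_def sq cmod_power2 by simp_all
  then have ab: "integrable lborel a" "integrable lborel b"
    by (auto intro!: Bochner_Integration.integrable_bound[OF square_integrableD[OF h]])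
  have i: "integrable lborel (\<lambda>x. a (x - s) - a x)" "integrable lborel (\<lambda>x. b (x - s) - b x)" for s
    using ab by (simp_all add: integrable_lborel_translate_iff)
  have le: "(cmod (h (x - s) - h x))\<^sup>2 \<le> 2 * (norm (a (x - s) - a x) + norm (b (x - s) - b x))" for x s
    using norm_diff_sq_le_signed_sq[of "Re (h (x - s))" "Re (h x)"]
      norm_diff_sq_le_signed_sq[of "Im (h (x - s))" "Im (h x)"]
    by (simp add: cmod_power2 a_def b_def)
  have bound: "(\<integral>x. (cmod (h (x - s) - h x))\<^sup>2 \<partial>lborel)
      \<le> 2 * ((\<integral>x. norm (a (x - s) - a x) \<partial>lborel) + (\<integral>x. norm (b (x - s) - b x) \<partial>lborel))" for s
  proof -
    have "(\<integral>x. (cmod (h (x - s) - h x))\<^sup>2 \<partial>lborel)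
        \<le> (\<integral>x. 2 * (norm (a (x - s) - a x) + norm (b (x - s) - b x)) \<partial>lborel)"
    proof (rule integral_mono[OF _ _ le])
      show "integrable lborel (\<lambda>x. (cmod (h (x - s) - h x))\<^sup>2)"
        using square_integrableD[OF square_integrable_add_cmult[OF square_integrable_translate[OF h, of s] h, of "-1"]]
        by simp
    qed (use i in auto)
    then show ?thesis using i[of s] by simp
  qed
  have lim: "(\<lambda>n. 2 * ((\<integral>x. norm (a (x - t n) - a x) \<partial>lborel) + (\<integral>x. norm (b (x - t n) - b x) \<partial>lborel)))
      \<longlonglongrightarrow> 2 * (0 + 0)"
    using integrable_translation_tendsto[OF t ab(1)] integrable_translation_tendsto[OF t ab(2)]
    unfolding translation_tendsto_def by (rule tendsto_mult[OF tendsto_const tendsto_add])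
  show ?thesis
  proof (rule tendsto_sandwich[OF always_eventually always_eventually tendsto_const])
    show "\<forall>n. (\<integral>x. (cmod (h (x - t n) - h x))\<^sup>2 \<partial>lborel)
      \<le> 2 * ((\<integral>x. norm (a (x - t n) - a x) \<partial>lborel) + (\<integral>x. norm (b (x - t n) - b x) \<partial>lborel))"
      using bound by blast
    show "\<forall>n. 0 \<le> (\<integral>x. (cmod (h (x - t n) - h x))\<^sup>2 \<partial>lborel)"
      by simp
  qed (use lim in simp)
qed

text \<open>The convolution of \<open>h\<close> with the function sending u to
  \<open>cnj (h (- u))\<close>. Its value at 0 is the squared L2 norm of \<open>h\<close>, so
  Plancherel's identity is Fourier inversion of this function at the single point 0.\<close>

definition autocorrelation :: "('a::euclidean_space \<Rightarrow> complex) \<Rightarrow> 'a \<Rightarrow> complex" where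
  "autocorrelation h w = (\<integral>u. h u * cnj (h (u - w)) \<partial>lborel)"

lemma autocorrelation_bound:
  assumes h: "square_integrable lborel h"
  shows "cmod (autocorrelation h w) \<le> (\<integral>u. (cmod (h u))\<^sup>2 \<partial>lborel)"
proof -
  have [measurable]: "h \<in> borel_measurable borel"
    using h by (simp add: square_integrable_def)
  note hw = square_integrable_translate[OF h, of w]
  have "cmod (autocorrelation h w) \<le> (\<integral>u. cmod (h u * cnj (h (u - w))) \<partial>lborel)"
    unfolding autocorrelation_def by (rule integral_norm_bound)
  also have "\<dots> \<le> (\<integral>u. ((cmod (h u))\<^sup>2 + (cmod (h (u - w)))\<^sup>2) / 2 \<partial>lborel)"
    using square_integrable_mult_cnj[OF h hw] h[THEN square_integrableD] hw[THEN square_integrableD]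
      cmod_mult_le_sq[of "h u" "cnj (h (u - w))" for u]
    by (intro integral_mono) auto
  also have "\<dots> = ((\<integral>u. (cmod (h u))\<^sup>2 \<partial>lborel) + (\<integral>u. (cmod (h (u - w)))\<^sup>2 \<partial>lborel)) / 2"
    using h[THEN square_integrableD] hw[THEN square_integrableD] by simp
  also have "(\<integral>u. (cmod (h (u - w)))\<^sup>2 \<partial>lborel) = (\<integral>u. (cmod (h u))\<^sup>2 \<partial>lborel)"
    by (rule integral_lborel_translate) measurable
  finally show ?thesis by simp
qed

text \<open>The difference is the inner product of \<open>h\<close> with an increment that tends to
  0 in L2. A weighted arithmetic-geometric mean inequality does the work of Cauchy-Schwarz.\<close>

lemma autocorrelation_tendsto:
  assumes t: "t \<longlonglongrightarrow> 0" and h: "square_integrable lborel h"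
  shows "(\<lambda>n. autocorrelation h (t n)) \<longlonglongrightarrow> autocorrelation h 0"
proof -
  define A where "A = (\<integral>x. (cmod (h x))\<^sup>2 \<partial>lborel)"
  define D where "D n = (\<integral>x. (cmod (h (x - t n) - h x))\<^sup>2 \<partial>lborel)" for n
  have D: "D \<longlonglongrightarrow> 0"
    using square_integrable_translation_tendsto[OF t h] by (simp add: D_def[abs_def])
  \<comment> \<open>The free weight \<open>e\<close> balances the fixed norm \<open>A\<close>
    against the vanishing \<open>D n\<close>; it enters by writing a product x y as (sqrt e x) (y /
    sqrt e).\<close>
  have le: "cmod (autocorrelation h (t n) - autocorrelation h 0) \<le> (e * A + D n / e) / 2" if e: "e > 0" for n e
  proof -
    note hn = square_integrable_translate[OF h, of "t n"]
    have d: "square_integrable lborel (\<lambda>x. h (x - t n) - h x)"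
      using square_integrable_add_cmult[OF hn h, of "-1"] by simp
    have "autocorrelation h (t n) - autocorrelation h 0 = (\<integral>x. h x * cnj (h (x - t n) - h x) \<partial>lborel)"
      using square_integrable_mult_cnj[OF h hn] square_integrable_mult_cnj[OF h h]
      by (simp add: autocorrelation_def ring_distribs)
    also have "cmod \<dots> \<le> (\<integral>x. cmod (h x * cnj (h (x - t n) - h x)) \<partial>lborel)"
      by (rule integral_norm_bound)
    also have "\<dots> \<le> (\<integral>x. (e * (cmod (h x))\<^sup>2 + (cmod (h (x - t n) - h x))\<^sup>2 / e) / 2 \<partial>lborel)"
    proof (rule integral_mono)
      fix x
      have "cmod (h x * cnj (h (x - t n) - h x)) = (sqrt e * cmod (h x)) * (cmod (h (x - t n) - h x) / sqrt e)"
        using e by (simp add: norm_mult flip: complex_cnj_diff)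
      also have "\<dots> \<le> ((sqrt e * cmod (h x))\<^sup>2 + (cmod (h (x - t n) - h x) / sqrt e)\<^sup>2) / 2"
        by (rule prod_le_mean_sq)
      finally show "cmod (h x * cnj (h (x - t n) - h x)) \<le> (e * (cmod (h x))\<^sup>2 + (cmod (h (x - t n) - h x))\<^sup>2 / e) / 2"
        using e by (simp add: power_mult_distrib power_divide)
    qed (use square_integrable_mult_cnj[OF h d] square_integrableD[OF h] square_integrableD[OF d] in auto)
    also have "\<dots> = (e * A + D n / e) / 2"
      using square_integrableD[OF h] square_integrableD[OF d] by (simp add: A_def D_def)
    finally show ?thesis .
  qed
  have A: "A \<ge> 0" by (simp add: A_def integral_nonneg_AE)
  show ?thesis
  proof (rule LIMSEQ_I)
    fix r :: real assume r: "r > 0"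
    \<comment> \<open>This choice gives \<open>e * A \<le> r\<close>; once
      \<open>D n < r * e\<close>, the second term is below \<open>r\<close>, so half of the sum is
      below \<open>r\<close> as well. The summand 1 covers \<open>A = 0\<close>.\<close>
    define e where "e = r / (A + 1)"
    have e: "e > 0" using r A by (simp add: e_def add_nonneg_pos)
    have eA: "e * A \<le> r" using r A by (simp add: e_def field_simps)
    obtain N where N: "\<And>n. n \<ge> N \<Longrightarrow> norm (D n - 0) < r * e"
      using LIMSEQ_D[OF D, of "r * e"] r e by auto
    have "norm (autocorrelation h (t n) - autocorrelation h 0) < r" if "n \<ge> N" for n
    proof -
      have "D n < r * e" using N[OF that] by auto
      then have "D n / e < r" using e by (simp add: field_simps)
      then show ?thesis using le[OF e, of n] eA by simp
    qed
    then show "\<exists>no. \<forall>n\<ge>no. norm (autocorrelation h (t n) - autocorrelation h 0) < r" by blast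
  qed
qed

section \<open>The Fourier transform and Gaussians\<close>

definition gaussian :: "'a::euclidean_space \<Rightarrow> real" where
  "gaussian x = exp (- (norm x)\<^sup>2 / 2)"

text \<open>Lebesgue measure is the image of the product of one-dimensional Lebesgue measures under
  the basis expansion. This reduces Gaussian integrals in any dimension to the line.\<close>

lemma
  fixes f :: "'a::euclidean_space \<Rightarrow> real \<Rightarrow> complex"
  assumes f: "\<And>b. b \<in> Basis \<Longrightarrow> integrable lborel (f b)"
  shows integrable_lborel_prod: "integrable lborel (\<lambda>x. \<Prod>b\<in>Basis. f b (x \<bullet> b))"
    and integral_lborel_prod:
      "(\<integral>x. (\<Prod>b\<in>Basis. f b (x \<bullet> b)) \<partial>lborel) = (\<Prod>b\<in>Basis. \<integral>x. f b x \<partial>lborel)"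
proof -
  interpret product_sigma_finite "\<lambda>_::'a. lborel :: real measure" ..
  have [measurable]: "\<And>b. b \<in> Basis \<Longrightarrow> f b \<in> borel_measurable borel"
    using f[THEN borel_measurable_integrable] by simp
  have eq: "(\<Prod>b\<in>Basis. f b ((\<Sum>b'\<in>Basis. x b' *\<^sub>R b') \<bullet> b)) = (\<Prod>b\<in>Basis. f b (x b))" for x
    by (intro prod.cong refl) simp
  show "integrable lborel (\<lambda>x. \<Prod>b\<in>Basis. f b (x \<bullet> b))"
    by (subst lborel_eq, subst integrable_distr_eq)
      (auto simp: eq intro!: product_integrable_prod f)
  show "(\<integral>x. (\<Prod>b\<in>Basis. f b (x \<bullet> b)) \<partial>lborel) = (\<Prod>b\<in>Basis. \<integral>x. f b x \<partial>lborel)"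
    by (subst lborel_eq, subst integral_distr)
      (auto simp: eq intro!: product_integral_prod f)
qed

text \<open>Up to the normalising constant \<open>sqrt (2 * pi)\<close> of its density, this is the
  characteristic function of the standard normal distribution.\<close>

lemma
  shows integrable_exp_sq: "integrable lborel (\<lambda>x. cis (t * x) * complex_of_real (exp (- x\<^sup>2 / 2)))"
    and integral_exp_sq: "(\<integral>x. cis (t * x) * complex_of_real (exp (- x\<^sup>2 / 2)) \<partial>lborel)
      = complex_of_real (sqrt (2 * pi) * exp (- t\<^sup>2 / 2))"
proof -
  have eq: "cis (t * x) * complex_of_real (exp (- x\<^sup>2 / 2))
      = sqrt (2 * pi) * (std_normal_density x *\<^sub>R iexp (t * x))" for x
    by (simp add: std_normal_density_def cis_conv_exp scaleR_conv_of_real)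
  interpret real_distribution std_normal_distribution by (rule real_dist_normal_dist)
  have "integrable std_normal_distribution (\<lambda>x. iexp (t * x))"
    by (intro integrable_const_bound[where B=1]) auto
  then have "integrable lborel (\<lambda>x. std_normal_density x *\<^sub>R iexp (t * x))"
    by (simp add: integrable_density)
  then show "integrable lborel (\<lambda>x. cis (t * x) * complex_of_real (exp (- x\<^sup>2 / 2)))"
    unfolding eq by (rule integrable_mult_right)
  have "(\<integral>x. std_normal_density x *\<^sub>R iexp (t * x) \<partial>lborel) = char std_normal_distribution t"
    unfolding char_def by (subst integral_density) auto
  then show "(\<integral>x. cis (t * x) * complex_of_real (exp (- x\<^sup>2 / 2)) \<partial>lborel)
      = complex_of_real (sqrt (2 * pi) * exp (- t\<^sup>2 / 2))"
    unfolding eq integral_mult_right_zero char_std_normal_distribution by simp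
qed

lemma gaussian_eq_prod: "gaussian x = (\<Prod>b\<in>Basis. exp (- (x \<bullet> b)\<^sup>2 / 2))"
proof -
  have "(norm x)\<^sup>2 = (\<Sum>b\<in>Basis. (x \<bullet> b)\<^sup>2)"
    unfolding power2_norm_eq_inner euclidean_inner[of x x] by (simp only: power2_eq_square)
  then have "- (norm x)\<^sup>2 / 2 = (\<Sum>b\<in>Basis. - (x \<bullet> b)\<^sup>2 / 2)"
    by (simp add: sum_negf sum_divide_distrib)
  then show ?thesis
    unfolding gaussian_def by (simp only: exp_sum[OF finite_Basis])
qed

lemma cis_inner_gaussian_eq_prod:
  fixes w x :: "'a::euclidean_space"
  shows "cis (w \<bullet> x) * complex_of_real (gaussian x)
    = (\<Prod>b\<in>Basis. cis ((w \<bullet> b) * (x \<bullet> b)) * complex_of_real (exp (- (x \<bullet> b)\<^sup>2 / 2)))"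
proof -
  have "cis (w \<bullet> x) = (\<Prod>b\<in>Basis. cis ((w \<bullet> b) * (x \<bullet> b)))"
    by (simp add: euclidean_inner[of w x] cis_conv_exp sum_distrib_left exp_sum)
  then show ?thesis by (simp add: prod.distrib gaussian_eq_prod)
qed

text \<open>The Gaussian is an eigenfunction of the Fourier transform, with one factor
  \<open>sqrt (2 * pi)\<close> per coordinate.\<close>

lemma
  fixes w :: "'a::euclidean_space"
  shows integrable_cis_gaussian: "integrable lborel (\<lambda>x. cis (w \<bullet> x) * complex_of_real (gaussian x))"
    and integral_cis_gaussian: "(\<integral>x. cis (w \<bullet> x) * complex_of_real (gaussian x) \<partial>lborel)
      = complex_of_real (sqrt (2 * pi) ^ DIM('a) * gaussian w)"
proof -
  show "integrable lborel (\<lambda>x. cis (w \<bullet> x) * complex_of_real (gaussian x))"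
    unfolding cis_inner_gaussian_eq_prod by (intro integrable_lborel_prod integrable_exp_sq)
  have "(\<integral>x. cis (w \<bullet> x) * complex_of_real (gaussian x) \<partial>lborel)
      = (\<Prod>b\<in>Basis. complex_of_real (sqrt (2 * pi) * exp (- (w \<bullet> b)\<^sup>2 / 2)))"
    unfolding cis_inner_gaussian_eq_prod
    by (subst integral_lborel_prod) (simp_all only: integrable_exp_sq integral_exp_sq)
  also have "\<dots> = complex_of_real (sqrt (2 * pi) ^ DIM('a) * gaussian w)"
    by (simp add: prod.distrib gaussian_eq_prod)
  finally show "(\<integral>x. cis (w \<bullet> x) * complex_of_real (gaussian x) \<partial>lborel)
      = complex_of_real (sqrt (2 * pi) ^ DIM('a) * gaussian w)" .
qed

lemma gaussian_measurable [measurable]: "gaussian \<in> borel_measurable borel"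
  unfolding gaussian_def[abs_def] by measurable

lemma gaussian_nonneg [simp]: "0 \<le> gaussian x"
  by (simp add: gaussian_def)

lemma cis_measurable [measurable (raw)]:
  "f \<in> borel_measurable M \<Longrightarrow> (\<lambda>x. cis (f x)) \<in> borel_measurable M"
  by (rule borel_measurable_continuous_on) (intro continuous_intros)

lemma
  shows integrable_gaussian: "integrable lborel (gaussian :: 'a::euclidean_space \<Rightarrow> real)"
    and integral_gaussian: "(\<integral>x. gaussian (x :: 'a) \<partial>lborel) = sqrt (2 * pi) ^ DIM('a)"
proof -
  have "integrable lborel (\<lambda>x::'a. complex_of_real (gaussian x))"
    using integrable_cis_gaussian[of "0 :: 'a"] by simp
  then show "integrable lborel (gaussian :: 'a \<Rightarrow> real)"
    unfolding complex_of_real_integrable_eq by simp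
  have "complex_of_real (\<integral>x. gaussian (x :: 'a) \<partial>lborel) = complex_of_real (sqrt (2 * pi) ^ DIM('a))"
    using integral_cis_gaussian[of "0 :: 'a"] by (simp add: gaussian_def del: of_real_power)
  then show "(\<integral>x. gaussian (x :: 'a) \<partial>lborel) = sqrt (2 * pi) ^ DIM('a)"
    unfolding of_real_eq_iff .
qed

text \<open>The exponent has a positive sign and no normalising constant is included, so a factor
  \<open>(2 * pi) ^ DIM('a)\<close> appears in Plancherel's identity.\<close>

definition fourier :: "('a::euclidean_space \<Rightarrow> complex) \<Rightarrow> 'a \<Rightarrow> complex" where
  "fourier h y = (\<integral>x. cis (x \<bullet> y) * h x \<partial>lborel)"

lemma integrable_cis_mult:
  fixes h :: "'a \<Rightarrow> complex"
  assumes "integrable M h" and [measurable]: "g \<in> borel_measurable M"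
  shows "integrable M (\<lambda>x. cis (g x) * h x)"
  using assms(1) borel_measurable_integrable[OF assms(1)]
  by (intro Bochner_Integration.integrable_bound[OF assms(1)]) (auto simp: norm_mult)

lemma fourier_measurable [measurable]:
  assumes [measurable]: "h \<in> borel_measurable borel"
  shows "fourier h \<in> borel_measurable borel"
proof -
  have "(\<lambda>y. \<integral>x. cis (x \<bullet> y) * h x \<partial>lborel) \<in> borel_measurable borel"
    by (rule lborel.borel_measurable_lebesgue_integral) measurable
  then show ?thesis by (simp add: fourier_def[abs_def])
qed

lemma cmod_fourier_le: "cmod (fourier h y) \<le> (\<integral>x. cmod (h x) \<partial>lborel)"
  unfolding fourier_def using integral_norm_bound[of lborel "\<lambda>x. cis (x \<bullet> y) * h x"]
  by (simp add: norm_mult)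

text \<open>The multiplication formula: Fubini moves the transform from \<open>c\<close> to the
  scaled Gaussian, whose transform is known. The Jacobian of the scaling in y is cancelled by
  substituting w = e x afterwards.\<close>

lemma integral_fourier_gaussian:
  fixes c :: "'a::euclidean_space \<Rightarrow> complex"
  assumes c: "integrable lborel c" and e: "e > 0"
  shows "(\<integral>y. fourier c y * complex_of_real (gaussian (e *\<^sub>R y)) \<partial>lborel)
    = complex_of_real (sqrt (2 * pi) ^ DIM('a)) * (\<integral>x. complex_of_real (gaussian x) * c (e *\<^sub>R x) \<partial>lborel)"
proof -
  have [measurable]: "c \<in> borel_measurable borel" using borel_measurable_integrable[OF c] by simp
  have ge: "integrable lborel (\<lambda>y::'a. complex_of_real (gaussian (e *\<^sub>R y)))"
    using integrable_lborel_affine_iff[of e "\<lambda>x::'a. complex_of_real (gaussian x)" 0] e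
      integrable_gaussian[where 'a='a] by (simp add: complex_of_real_integrable_eq)
  \<comment> \<open>The Gaussian supplies integrability in y and \<open>c\<close> supplies it in w;
    the unimodular factor does not affect absolute integrability.\<close>
  have i: "integrable (lborel \<Otimes>\<^sub>M lborel)
    (\<lambda>(y, w). cis (w \<bullet> y) * (complex_of_real (gaussian (e *\<^sub>R y)) * c w))"
  proof -
    have "integrable (lborel \<Otimes>\<^sub>M lborel) (\<lambda>z :: 'a \<times> 'a. complex_of_real (gaussian (e *\<^sub>R fst z)) * c (snd z))"
    proof (rule lborel_pair.Fubini_integrable)
      show "integrable lborel (\<lambda>x :: 'a. \<integral>y. norm (complex_of_real (gaussian (e *\<^sub>R fst (x, y))) * c (snd (x, y))) \<partial>lborel)"
        using integrable_norm[OF ge] by (simp add: norm_mult)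
      show "AE x :: 'a in lborel. integrable lborel (\<lambda>y. complex_of_real (gaussian (e *\<^sub>R fst (x, y))) * c (snd (x, y)))"
        using c by simp
    qed measurable
    from integrable_cis_mult[OF this, of "\<lambda>z. snd z \<bullet> fst z"] show ?thesis
      by (simp add: case_prod_beta')
  qed
  have "(\<integral>y. fourier c y * complex_of_real (gaussian (e *\<^sub>R y)) \<partial>lborel)
    = (\<integral>y. \<integral>w. cis (w \<bullet> y) * (complex_of_real (gaussian (e *\<^sub>R y)) * c w) \<partial>lborel \<partial>lborel)"
  proof (rule Bochner_Integration.integral_cong[OF refl])
    fix y
    show "fourier c y * complex_of_real (gaussian (e *\<^sub>R y))
      = (\<integral>w. cis (w \<bullet> y) * (complex_of_real (gaussian (e *\<^sub>R y)) * c w) \<partial>lborel)"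
      by (simp add: fourier_def mult_ac flip: integral_mult_right_zero)
  qed
  also have "\<dots> = (\<integral>w. \<integral>y. cis (w \<bullet> y) * (complex_of_real (gaussian (e *\<^sub>R y)) * c w) \<partial>lborel \<partial>lborel)"
    using lborel_pair.Fubini_integral[OF i] by simp
  also have "\<dots> = (\<integral>w. c w * (inverse (e ^ DIM('a)) *\<^sub>R complex_of_real (sqrt (2 * pi) ^ DIM('a) * gaussian (w /\<^sub>R e))) \<partial>lborel)"
  proof (rule Bochner_Integration.integral_cong[OF refl])
    fix w :: 'a
    \<comment> \<open>The summand 0 brings the integrand into the shape t + c x of the affine
      substitution.\<close>
    have w: "(w /\<^sub>R e) \<bullet> (0 + e *\<^sub>R y) = w \<bullet> y" for y :: 'a
      using e by simp
    have "(\<integral>y. cis (w \<bullet> y) * (complex_of_real (gaussian (e *\<^sub>R y)) * c w) \<partial>lborel)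
      = c w * (\<integral>y. cis ((w /\<^sub>R e) \<bullet> (0 + e *\<^sub>R y)) * complex_of_real (gaussian (0 + e *\<^sub>R y)) \<partial>lborel)"
      unfolding w by (simp add: mult_ac flip: integral_mult_right_zero)
    also have "(\<integral>y. cis ((w /\<^sub>R e) \<bullet> (0 + e *\<^sub>R y)) * complex_of_real (gaussian (0 + e *\<^sub>R y)) \<partial>lborel)
      = inverse (e ^ DIM('a)) *\<^sub>R complex_of_real (sqrt (2 * pi) ^ DIM('a) * gaussian (w /\<^sub>R e))"
      using e integral_lborel_affine[of e "\<lambda>z. cis ((w /\<^sub>R e) \<bullet> z) * complex_of_real (gaussian z)" 0]
      unfolding integral_cis_gaussian by simp
    finally show "(\<integral>y. cis (w \<bullet> y) * (complex_of_real (gaussian (e *\<^sub>R y)) * c w) \<partial>lborel)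
      = c w * (inverse (e ^ DIM('a)) *\<^sub>R complex_of_real (sqrt (2 * pi) ^ DIM('a) * gaussian (w /\<^sub>R e)))" .
  qed
  also have "\<dots> = complex_of_real (sqrt (2 * pi) ^ DIM('a)) * (inverse (e ^ DIM('a)) *\<^sub>R (\<integral>w. complex_of_real (gaussian (w /\<^sub>R e)) * c w \<partial>lborel))"
    by (simp add: scaleR_conv_of_real mult_ac flip: integral_mult_right_zero)
  also have "inverse (e ^ DIM('a)) *\<^sub>R (\<integral>w. complex_of_real (gaussian (w /\<^sub>R e)) * c w \<partial>lborel)
    = (\<integral>x. complex_of_real (gaussian ((0 + e *\<^sub>R x) /\<^sub>R e)) * c (0 + e *\<^sub>R x) \<partial>lborel)"
    using e by (subst integral_lborel_affine[of e]) simp_all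
  finally show ?thesis using e by simp
qed

text \<open>Fourier inversion at 0 by Gaussian summation, without assuming that
  \<open>fourier c\<close> is integrable. After the multiplication formula with e = 1 / (n + 1), the
  arguments of \<open>c\<close> shrink to 0 while a multiple of the Gaussian dominates.\<close>

lemma integral_fourier_gaussian_tendsto:
  fixes c :: "'a::euclidean_space \<Rightarrow> complex"
  assumes c: "integrable lborel c" and B: "\<And>x. cmod (c x) \<le> B"
    and cont: "\<And>t. t \<longlonglongrightarrow> 0 \<Longrightarrow> (\<lambda>n. c (t n)) \<longlonglongrightarrow> c 0"
  shows "(\<lambda>n. \<integral>y. fourier c y * complex_of_real (gaussian (y /\<^sub>R real (Suc n))) \<partial>lborel)
    \<longlonglongrightarrow> complex_of_real ((2 * pi) ^ DIM('a)) * c 0"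
proof -
  have [measurable]: "c \<in> borel_measurable borel" using borel_measurable_integrable[OF c] by simp
  have "(\<lambda>n. \<integral>x. complex_of_real (gaussian x) * c (x /\<^sub>R real (Suc n)) \<partial>lborel)
    \<longlonglongrightarrow> (\<integral>x. complex_of_real (gaussian (x :: 'a)) * c 0 \<partial>lborel)"
  proof (rule integral_dominated_convergence[where w="\<lambda>x. gaussian x * B"])
    show "integrable lborel (\<lambda>x::'a. gaussian x * B)"
      using integrable_gaussian[where 'a='a] by simp
    have "(\<lambda>n. x /\<^sub>R real (Suc n)) \<longlonglongrightarrow> 0" for x :: 'a
      using tendsto_scaleR[OF LIMSEQ_inverse_real_of_nat tendsto_const[of x]] by simp
    then show "AE x in lborel. (\<lambda>n. complex_of_real (gaussian x) * c (x /\<^sub>R real (Suc n)))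
      \<longlonglongrightarrow> complex_of_real (gaussian x) * c 0"
      by (intro AE_I2 tendsto_mult[OF tendsto_const] cont)
    show "AE x in lborel. norm (complex_of_real (gaussian x) * c (x /\<^sub>R real (Suc n))) \<le> gaussian x * B" for n
      using B by (intro AE_I2) (simp add: norm_mult mult_left_mono)
  qed measurable
  also have "(\<integral>x. complex_of_real (gaussian (x :: 'a)) * c 0 \<partial>lborel) = complex_of_real (sqrt (2 * pi) ^ DIM('a)) * c 0"
    using integral_gaussian[where 'a='a] by simp
  finally have "(\<lambda>n. complex_of_real (sqrt (2 * pi) ^ DIM('a)) * (\<integral>x. complex_of_real (gaussian x) * c (x /\<^sub>R real (Suc n)) \<partial>lborel))
    \<longlonglongrightarrow> complex_of_real (sqrt (2 * pi) ^ DIM('a)) * (complex_of_real (sqrt (2 * pi) ^ DIM('a)) * c 0)"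
    by (rule tendsto_mult[OF tendsto_const])
  \<comment> \<open>One power of \<open>sqrt (2 * pi)\<close> comes from transforming the Gaussian,
    the other from its total integral.\<close>
  moreover have "complex_of_real (sqrt (2 * pi) ^ DIM('a)) * (complex_of_real (sqrt (2 * pi) ^ DIM('a)) * c 0)
    = complex_of_real ((2 * pi) ^ DIM('a)) * c 0"
  proof -
    have "sqrt (2 * pi) ^ DIM('a) * sqrt (2 * pi) ^ DIM('a) = (2 * pi) ^ DIM('a)"
      unfolding power_mult_distrib[symmetric] by simp
    then show ?thesis
      by (metis mult.assoc of_real_mult)
  qed
  moreover have "(\<integral>y. fourier c y * complex_of_real (gaussian (y /\<^sub>R real (Suc n))) \<partial>lborel)
    = complex_of_real (sqrt (2 * pi) ^ DIM('a)) * (\<integral>x. complex_of_real (gaussian x) * c (x /\<^sub>R real (Suc n)) \<partial>lborel)" for n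
    using integral_fourier_gaussian[OF c, of "inverse (real (Suc n))"] by (simp del: of_nat_Suc)
  ultimately show ?thesis by (simp only:)
qed

text \<open>Only \<open>l\<close> depends on w, and the reflection sending w to u - w makes its
  integral independent of u, so the double integral factors. It serves the autocorrelation, the
  squared moduli of windowed products, and the separation of signals from windows in the Moyal
  identity; the value type covers both real and complex functions.\<close>

lemma
  fixes k l :: "'a::euclidean_space \<Rightarrow> 'b::{real_normed_field, banach, second_countable_topology}"
  assumes k: "integrable lborel k" and l: "integrable lborel l"
  shows integrable_mult_diff: "integrable (lborel \<Otimes>\<^sub>M lborel) (\<lambda>(u, w). k u * l (u - w))"
    and integral_mult_diff: "(\<integral>w. \<integral>u. k u * l (u - w) \<partial>lborel \<partial>lborel) = (\<integral>u. k u \<partial>lborel) * (\<integral>u. l u \<partial>lborel)"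
proof -
  have [measurable]: "k \<in> borel_measurable borel" "l \<in> borel_measurable borel"
    using k l by (simp_all add: borel_measurable_integrable flip: measurable_lborel1)
  show i: "integrable (lborel \<Otimes>\<^sub>M lborel) (\<lambda>(u, w). k u * l (u - w))"
  proof (rule lborel_pair.Fubini_integrable)
    have "(\<integral>w. norm (l (u - w)) \<partial>lborel) = (\<integral>w. norm (l w) \<partial>lborel)" for u
      by (rule integral_lborel_reflect) measurable
    then show "integrable lborel (\<lambda>u. \<integral>w. norm (case (u, w) of (u, w) \<Rightarrow> k u * l (u - w)) \<partial>lborel)"
      using integrable_norm[OF k] by (simp add: norm_mult)
    show "AE u in lborel. integrable lborel (\<lambda>w. case (u, w) of (u, w) \<Rightarrow> k u * l (u - w))"
      using l by (simp add: integrable_lborel_reflect_iff)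
  qed measurable
  have "(\<integral>w. \<integral>u. k u * l (u - w) \<partial>lborel \<partial>lborel) = (\<integral>u. \<integral>w. k u * l (u - w) \<partial>lborel \<partial>lborel)"
    using lborel_pair.Fubini_integral[OF i] by simp
  also have "\<dots> = (\<integral>u. k u * (\<integral>w. l w \<partial>lborel) \<partial>lborel)"
    by (simp add: integral_lborel_reflect)
  finally show "(\<integral>w. \<integral>u. k u * l (u - w) \<partial>lborel \<partial>lborel) = (\<integral>u. k u \<partial>lborel) * (\<integral>u. l u \<partial>lborel)"
    by simp
qed

lemma
  fixes h :: "'a::euclidean_space \<Rightarrow> complex"
  assumes h: "integrable lborel h"
  shows integrable_autocorrelation: "integrable lborel (autocorrelation h)"
    and fourier_autocorrelation: "fourier (autocorrelation h) y = fourier h y * cnj (fourier h y)"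
proof -
  have [measurable]: "h \<in> borel_measurable borel" using borel_measurable_integrable[OF h] by simp
  have i: "integrable (lborel \<Otimes>\<^sub>M lborel) (\<lambda>(u, w). h u * cnj (h (u - w)))"
    using integrable_mult_diff[OF h, of "\<lambda>u. cnj (h u)"] h by simp
  show "integrable lborel (autocorrelation h)"
    using lborel_pair.integrable_snd[OF i] by (simp add: autocorrelation_def[abs_def])
  have i2: "integrable (lborel \<Otimes>\<^sub>M lborel) (\<lambda>(u, w). cis (w \<bullet> y) * (h u * cnj (h (u - w))))"
    using integrable_cis_mult[OF i, of "\<lambda>z. snd z \<bullet> y"] by (simp add: case_prod_beta')
  have "fourier (autocorrelation h) y = (\<integral>w. \<integral>u. cis (w \<bullet> y) * (h u * cnj (h (u - w))) \<partial>lborel \<partial>lborel)"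
    unfolding fourier_def autocorrelation_def by simp
  also have "\<dots> = (\<integral>u. \<integral>w. cis (w \<bullet> y) * (h u * cnj (h (u - w))) \<partial>lborel \<partial>lborel)"
    using lborel_pair.Fubini_integral[OF i2] by simp
  also have "\<dots> = (\<integral>u. cis (u \<bullet> y) * h u * cnj (fourier h y) \<partial>lborel)"
  proof (rule Bochner_Integration.integral_cong[OF refl])
    fix u
    have "(\<integral>w. cis (w \<bullet> y) * (h u * cnj (h (u - w))) \<partial>lborel)
      = (\<integral>w. cis (u \<bullet> y) * h u * cnj (cis ((u - w) \<bullet> y) * h (u - w)) \<partial>lborel)"
    proof (rule Bochner_Integration.integral_cong[OF refl])
      fix w
      \<comment> \<open>Writing w = u - (u - w) splits the character into a factor for each
        occurrence of \<open>h\<close>; the minus sign turns into the conjugation that produces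
        \<open>cnj (fourier h y)\<close>.\<close>
      have "cis (w \<bullet> y) = cis (u \<bullet> y) * cnj (cis ((u - w) \<bullet> y))"
        by (simp add: inner_diff_left cis_cnj cis_mult)
      then show "cis (w \<bullet> y) * (h u * cnj (h (u - w))) = cis (u \<bullet> y) * h u * cnj (cis ((u - w) \<bullet> y) * h (u - w))"
        by (simp only: complex_cnj_mult mult_ac)
    qed
    also have "\<dots> = (\<integral>v. cis (u \<bullet> y) * h u * cnj (cis (v \<bullet> y) * h v) \<partial>lborel)"
      by (rule integral_lborel_reflect) measurable
    also have "\<dots> = cis (u \<bullet> y) * h u * cnj (fourier h y)"
      by (simp only: integral_mult_right_zero Bochner_Integration.integral_cnj fourier_def)
    finally show "(\<integral>w. cis (w \<bullet> y) * (h u * cnj (h (u - w))) \<partial>lborel) = cis (u \<bullet> y) * h u * cnj (fourier h y)" .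
  qed
  also have "\<dots> = fourier h y * cnj (fourier h y)"
    by (simp add: fourier_def)
  finally show "fourier (autocorrelation h) y = fourier h y * cnj (fourier h y)" .
qed

section \<open>Plancherel's theorem\<close>

text \<open>The weights \<open>gaussian (y /\<^sub>R real (Suc n))\<close> increase to 1 and their
  weighted integrals converge by inversion of the autocorrelation at 0. Monotone convergence then
  delivers the integrability of the squared transform and its integral at once.\<close>

lemma
  fixes h :: "'a::euclidean_space \<Rightarrow> complex"
  assumes h1: "integrable lborel h" and h2: "square_integrable lborel h"
  shows square_integrable_fourier: "square_integrable lborel (fourier h)"
    and plancherel_norm:
      "(\<integral>y. (cmod (fourier h y))\<^sup>2 \<partial>lborel) = (2 * pi) ^ DIM('a) * (\<integral>x. (cmod (h x))\<^sup>2 \<partial>lborel)"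
proof -
  let ?F = "\<lambda>n y. (cmod (fourier h y))\<^sup>2 * gaussian (y /\<^sub>R real (Suc n))"
  have [measurable]: "h \<in> borel_measurable borel" using borel_measurable_integrable[OF h1] by simp
  \<comment> \<open>\<open>h\<close> is integrable, so its transform is bounded by its L1 norm and
    the Gaussian supplies the decay.\<close>
  have int: "integrable lborel (?F n)" for n
  proof (rule Bochner_Integration.integrable_bound)
    define B where "B = (\<integral>x. cmod (h x) \<partial>lborel)"
    show "integrable lborel (\<lambda>y::'a. B\<^sup>2 * gaussian (y /\<^sub>R real (Suc n)))"
      using integrable_lborel_affine_iff[of "inverse (real (Suc n))" "gaussian :: 'a \<Rightarrow> real" 0]
        integrable_gaussian[where 'a='a] by simp
    show "AE y in lborel. norm (?F n y) \<le> norm (B\<^sup>2 * gaussian (y /\<^sub>R real (Suc n)))"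
      using cmod_fourier_le[of h] unfolding B_def
      by (intro AE_I2) (simp add: abs_mult mult_right_mono power_mono)
  qed measurable
  have mono: "mono (\<lambda>n. ?F n y)" for y
  proof (rule monoI)
    fix m n :: nat assume "m \<le> n"
    then have "norm (y /\<^sub>R real (Suc n)) \<le> norm (y /\<^sub>R real (Suc m))"
      by (simp add: mult_right_mono le_imp_inverse_le)
    then have "(norm (y /\<^sub>R real (Suc n)))\<^sup>2 \<le> (norm (y /\<^sub>R real (Suc m)))\<^sup>2"
      by (rule power_mono) simp
    then have "gaussian (y /\<^sub>R real (Suc m)) \<le> gaussian (y /\<^sub>R real (Suc n))"
      unfolding gaussian_def exp_le_cancel_iff by linarith
    then show "?F m y \<le> ?F n y" by (simp add: mult_left_mono)
  qed
  have lim: "(\<lambda>n. ?F n y) \<longlonglongrightarrow> (cmod (fourier h y))\<^sup>2" for y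
  proof -
    have "(\<lambda>n. y /\<^sub>R real (Suc n)) \<longlonglongrightarrow> 0"
      using tendsto_scaleR[OF LIMSEQ_inverse_real_of_nat tendsto_const[of y]] by simp
    then have "(\<lambda>n. (cmod (fourier h y))\<^sup>2 * exp (- (norm (y /\<^sub>R real (Suc n)))\<^sup>2 / 2))
        \<longlonglongrightarrow> (cmod (fourier h y))\<^sup>2 * exp (- (norm (0 :: 'a))\<^sup>2 / 2)"
      by (intro tendsto_intros) auto
    then show ?thesis by (simp add: gaussian_def)
  qed
  have "(\<lambda>n. \<integral>y. fourier (autocorrelation h) y * complex_of_real (gaussian (y /\<^sub>R real (Suc n))) \<partial>lborel)
    \<longlonglongrightarrow> complex_of_real ((2 * pi) ^ DIM('a)) * autocorrelation h 0"
    using integrable_autocorrelation[OF h1] autocorrelation_bound[OF h2] autocorrelation_tendsto[OF _ h2]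
    by (rule integral_fourier_gaussian_tendsto)
  moreover have "(\<integral>y. fourier (autocorrelation h) y * complex_of_real (gaussian (y /\<^sub>R real (Suc n))) \<partial>lborel)
    = complex_of_real (\<integral>y. ?F n y \<partial>lborel)" for n
    unfolding fourier_autocorrelation[OF h1] complex_norm_square[symmetric]
    by (simp flip: integral_complex_of_real)
  moreover have "autocorrelation h 0 = complex_of_real (\<integral>x. (cmod (h x))\<^sup>2 \<partial>lborel)"
    unfolding autocorrelation_def diff_zero complex_norm_square[symmetric] integral_complex_of_real ..
  ultimately have "(\<lambda>n. complex_of_real (\<integral>y. ?F n y \<partial>lborel))
      \<longlonglongrightarrow> complex_of_real ((2 * pi) ^ DIM('a) * (\<integral>x. (cmod (h x))\<^sup>2 \<partial>lborel))"
    by (simp only: of_real_mult)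
  then have ilim: "(\<lambda>n. \<integral>y. ?F n y \<partial>lborel) \<longlonglongrightarrow> (2 * pi) ^ DIM('a) * (\<integral>x. (cmod (h x))\<^sup>2 \<partial>lborel)"
    by (simp only: tendsto_of_real_iff)
  note conv = int AE_I2[OF mono] AE_I2[OF lim] ilim
  have m: "(\<lambda>y. (cmod (fourier h y))\<^sup>2) \<in> borel_measurable lborel" by measurable
  show "square_integrable lborel (fourier h)"
    unfolding square_integrable_def using integrable_monotone_convergence[OF conv m] by simp
  show "(\<integral>y. (cmod (fourier h y))\<^sup>2 \<partial>lborel) = (2 * pi) ^ DIM('a) * (\<integral>x. (cmod (h x))\<^sup>2 \<partial>lborel)"
    by (rule integral_monotone_convergence[OF conv m])
qed

lemma integral_norm_sq_add_cmult:
  assumes f: "square_integrable M f" and g: "square_integrable M g"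
  shows "(\<integral>x. (cmod (f x + c * g x))\<^sup>2 \<partial>M) = (\<integral>x. (cmod (f x))\<^sup>2 \<partial>M)
    + (cmod c)\<^sup>2 * (\<integral>x. (cmod (g x))\<^sup>2 \<partial>M) + 2 * Re (cnj c * (\<integral>x. f x * cnj (g x) \<partial>M))"
proof -
  have expand: "(cmod (a + c * b))\<^sup>2 = (cmod a)\<^sup>2 + (cmod c)\<^sup>2 * (cmod b)\<^sup>2 + 2 * Re (cnj c * (a * cnj b))"
    for a b
    unfolding cmod_power2 by (simp add: power2_eq_square algebra_simps)
  have i: "integrable M (\<lambda>x. cnj c * (f x * cnj (g x)))"
    using square_integrable_mult_cnj[OF f g] by simp
  have "(\<integral>x. (cmod (f x + c * g x))\<^sup>2 \<partial>M)
    = (\<integral>x. (cmod (f x))\<^sup>2 + (cmod c)\<^sup>2 * (cmod (g x))\<^sup>2 + 2 * Re (cnj c * (f x * cnj (g x))) \<partial>M)"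
    unfolding expand ..
  also have "\<dots> = (\<integral>x. (cmod (f x))\<^sup>2 \<partial>M) + (cmod c)\<^sup>2 * (\<integral>x. (cmod (g x))\<^sup>2 \<partial>M)
      + 2 * (\<integral>x. Re (cnj c * (f x * cnj (g x))) \<partial>M)"
    using f[THEN square_integrableD] g[THEN square_integrableD] integrable_Re[OF i]
    by (simp del: times_complex.sel)
  also have "(\<integral>x. Re (cnj c * (f x * cnj (g x))) \<partial>M) = Re (cnj c * (\<integral>x. f x * cnj (g x) \<partial>M))"
    using integral_Re[OF i] by simp
  finally show ?thesis .
qed

text \<open>Both sides are quadratic in \<open>c\<close>. Comparing c = 1 with c = -1 isolates the
  real part of the inner product, and c = \<i> with c = -\<i> the imaginary part. The two pairs of
  functions may live on different measure spaces.\<close>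

lemma polarization:
  assumes f: "square_integrable M f" and g: "square_integrable M g"
    and F: "square_integrable N F" and G: "square_integrable N G"
    and eq: "\<And>c. (\<integral>x. (cmod (F x + c * G x))\<^sup>2 \<partial>N) = K * (\<integral>x. (cmod (f x + c * g x))\<^sup>2 \<partial>M)"
  shows "(\<integral>x. F x * cnj (G x) \<partial>N) = complex_of_real K * (\<integral>x. f x * cnj (g x) \<partial>M)"
proof -
  define z w where "z = (\<integral>x. F x * cnj (G x) \<partial>N)" and "w = (\<integral>x. f x * cnj (g x) \<partial>M)"
  define A B a b where "A = (\<integral>x. (cmod (F x))\<^sup>2 \<partial>N)" and "B = (\<integral>x. (cmod (G x))\<^sup>2 \<partial>N)"
    and "a = (\<integral>x. (cmod (f x))\<^sup>2 \<partial>M)" and "b = (\<integral>x. (cmod (g x))\<^sup>2 \<partial>M)"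
  have *: "A + (cmod c)\<^sup>2 * B + 2 * Re (cnj c * z) = K * (a + (cmod c)\<^sup>2 * b + 2 * Re (cnj c * w))" for c
    using eq[of c] unfolding integral_norm_sq_add_cmult[OF f g] integral_norm_sq_add_cmult[OF F G]
    by (simp only: z_def w_def A_def B_def a_def b_def)
  have "Re z = K * Re w"
    using *[of 1] *[of "-1"] by (simp add: algebra_simps)
  moreover have "Im z = K * Im w"
    using *[of \<i>] *[of "-\<i>"] by (simp add: algebra_simps)
  ultimately show ?thesis by (simp add: complex_eq_iff flip: z_def w_def)
qed

lemma fourier_add_cmult:
  assumes "integrable lborel f" "integrable lborel g"
  shows "fourier (\<lambda>x. f x + c * g x) y = fourier f y + c * fourier g y"
  unfolding fourier_def using assms[THEN integrable_cis_mult, of "\<lambda>x. x \<bullet> y"]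
  by (simp add: distrib_left mult.left_commute)

theorem plancherel:
  fixes f g :: "'a::euclidean_space \<Rightarrow> complex"
  assumes f: "integrable lborel f" "square_integrable lborel f"
    and g: "integrable lborel g" "square_integrable lborel g"
  shows "(\<integral>y. fourier f y * cnj (fourier g y) \<partial>lborel)
    = complex_of_real ((2 * pi) ^ DIM('a)) * (\<integral>x. f x * cnj (g x) \<partial>lborel)"
proof (rule polarization[OF f(2) g(2) square_integrable_fourier[OF f] square_integrable_fourier[OF g]])
  fix c
  have "integrable lborel (\<lambda>x. f x + c * g x)" using f(1) g(1) by simp
  then show "(\<integral>x. (cmod (fourier f x + c * fourier g x))\<^sup>2 \<partial>lborel)
    = (2 * pi) ^ DIM('a) * (\<integral>x. (cmod (f x + c * g x))\<^sup>2 \<partial>lborel)"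
    using plancherel_norm[OF _ square_integrable_add_cmult[OF f(2) g(2)], of c]
      fourier_add_cmult[OF f(1) g(1), of c] by simp
qed

section \<open>The Moyal identity\<close>

text \<open>The complex transform without prefactor, in any dimension. The real frequency \<kappa>
  combines \<sigma> with the sign of the imaginary unit and may be negative.\<close>

definition fourier_wigner ::
  "real \<Rightarrow> ('a::euclidean_space \<Rightarrow> complex) \<Rightarrow> ('a \<Rightarrow> complex) \<Rightarrow> 'a \<Rightarrow> 'a \<Rightarrow> complex" where
  "fourier_wigner \<kappa> f g X Y = (\<integral>U. cis (\<kappa> * ((U - X /\<^sub>R 2) \<bullet> Y)) * f U * cnj (g (U - X)) \<partial>lborel)"

lemma fourier_wigner_eq_fourier:
  "fourier_wigner \<kappa> f g X Y
    = cis (- \<kappa> * (X \<bullet> Y) / 2) * fourier (\<lambda>U. f U * cnj (g (U - X))) (\<kappa> *\<^sub>R Y)"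
proof -
  have "cis (\<kappa> * ((U - X /\<^sub>R 2) \<bullet> Y)) = cis (- \<kappa> * (X \<bullet> Y) / 2) * cis (U \<bullet> (\<kappa> *\<^sub>R Y))" for U
    unfolding cis_mult by (rule arg_cong[of _ _ cis]) (simp add: inner_diff_left field_simps)
  then show ?thesis
    unfolding fourier_wigner_def fourier_def by (simp add: mult.assoc)
qed

lemma cmod_fourier_wigner:
  "cmod (fourier_wigner \<kappa> f g X Y) = cmod (fourier (\<lambda>U. f U * cnj (g (U - X))) (\<kappa> *\<^sub>R Y))"
  by (simp add: fourier_wigner_eq_fourier norm_mult)

lemma fourier_wigner_mult_cnj:
  "fourier_wigner \<kappa> f\<^sub>1 g\<^sub>1 X Y * cnj (fourier_wigner \<kappa> f\<^sub>2 g\<^sub>2 X Y)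
    = fourier (\<lambda>U. f\<^sub>1 U * cnj (g\<^sub>1 (U - X))) (\<kappa> *\<^sub>R Y)
      * cnj (fourier (\<lambda>U. f\<^sub>2 U * cnj (g\<^sub>2 (U - X))) (\<kappa> *\<^sub>R Y))"
proof -
  have "cis t * a * cnj (cis t * b) = a * cnj b" for t a b
    using cis_mult[of t "-t"] by (simp add: cis_cnj mult_ac)
  then show ?thesis by (simp only: fourier_wigner_eq_fourier)
qed

lemma fourier_wigner_measurable [measurable]:
  fixes f g :: "'a::euclidean_space \<Rightarrow> complex"
  assumes [measurable]: "f \<in> borel_measurable borel" "g \<in> borel_measurable borel"
  shows "(\<lambda>(X, Y). fourier_wigner \<kappa> f g X Y) \<in> borel_measurable (borel \<Otimes>\<^sub>M borel)"
proof -
  have "(\<lambda>p :: 'a \<times> 'a. \<integral>U. cis (\<kappa> * ((U - fst p /\<^sub>R 2) \<bullet> snd p)) * f U * cnj (g (U - fst p)) \<partial>lborel)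
    \<in> borel_measurable (borel \<Otimes>\<^sub>M borel)"
    by (rule lborel.borel_measurable_lebesgue_integral) measurable
  then show ?thesis by (simp add: fourier_wigner_def case_prod_beta')
qed

text \<open>For fixed X a product of two L2 functions is only guaranteed to be in L1. The squared
  moduli, however, form a product of two L1 functions at u and u - X, which is integrable on the
  product space, so almost every section is integrable.\<close>

lemma
  fixes f g :: "'a::euclidean_space \<Rightarrow> complex"
  assumes f: "square_integrable lborel f" and g: "square_integrable lborel g"
  shows AE_square_integrable_mult_translate:
      "AE X in lborel. square_integrable lborel (\<lambda>U. f U * cnj (g (U - X)))"
    and integrable_norm_sq_mult_translate:
      "integrable lborel (\<lambda>X. \<integral>U. (cmod (f U * cnj (g (U - X))))\<^sup>2 \<partial>lborel)"
proof -
  have [measurable]: "f \<in> borel_measurable borel" "g \<in> borel_measurable borel"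
    using f g by (simp_all add: square_integrable_def)
  have i: "integrable (lborel \<Otimes>\<^sub>M lborel) (\<lambda>(U, X). (cmod (f U * cnj (g (U - X))))\<^sup>2)"
    using integrable_mult_diff[OF square_integrableD[OF f] square_integrableD[OF g]]
    by (simp add: norm_mult power_mult_distrib)
  show "integrable lborel (\<lambda>X. \<integral>U. (cmod (f U * cnj (g (U - X))))\<^sup>2 \<partial>lborel)"
    by (rule lborel_pair.integrable_snd[OF i])
  show "AE X in lborel. square_integrable lborel (\<lambda>U. f U * cnj (g (U - X)))"
    using lborel_pair.AE_integrable_snd[OF i] by eventually_elim (simp add: square_integrable_def)
qed

lemma square_integrable_scale:
  fixes F :: "'a::euclidean_space \<Rightarrow> complex"
  assumes F: "square_integrable lborel F" and "\<kappa> \<noteq> 0"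
  shows "square_integrable lborel (\<lambda>y. F (\<kappa> *\<^sub>R y))"
proof -
  have [measurable]: "F \<in> borel_measurable borel" using F by (simp add: square_integrable_def)
  show ?thesis
    using integrable_lborel_affine_iff[of \<kappa> "\<lambda>y. (cmod (F y))\<^sup>2" 0] assms
    by (simp add: square_integrable_def)
qed

text \<open>For almost every X, Plancherel turns the integral over Y into a multiple of the squared
  norm of the windowed product, which is integrable in X. This is what permits Fubini for products
  of two transforms.\<close>

lemma square_integrable_fourier_wigner:
  fixes f g :: "'a::euclidean_space \<Rightarrow> complex"
  assumes f: "square_integrable lborel f" and g: "square_integrable lborel g" and \<kappa>: "\<kappa> \<noteq> 0"
  shows "square_integrable (lborel \<Otimes>\<^sub>M lborel) (\<lambda>(X, Y). fourier_wigner \<kappa> f g X Y)"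
proof -
  have [measurable]: "f \<in> borel_measurable borel" "g \<in> borel_measurable borel"
    using f g by (simp_all add: square_integrable_def)
  let ?h = "\<lambda>X U. f U * cnj (g (U - X))"
  have h1: "integrable lborel (?h X)" for X
    by (rule square_integrable_mult_cnj[OF f square_integrable_translate[OF g]])
  note h2 = AE_square_integrable_mult_translate[OF f g]
  have eq: "AE X in lborel. (\<integral>Y. (cmod (fourier_wigner \<kappa> f g X Y))\<^sup>2 \<partial>lborel)
    = (2 * pi) ^ DIM('a) / \<bar>\<kappa>\<bar> ^ DIM('a) * (\<integral>U. (cmod (?h X U))\<^sup>2 \<partial>lborel)"
    using h2
  proof eventually_elim
    case (elim X)
    have "(\<integral>Y. (cmod (fourier_wigner \<kappa> f g X Y))\<^sup>2 \<partial>lborel)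
      = inverse (\<bar>\<kappa>\<bar> ^ DIM('a)) *\<^sub>R (\<integral>Y. (cmod (fourier (?h X) Y))\<^sup>2 \<partial>lborel)"
      unfolding cmod_fourier_wigner
      using integral_lborel_affine[OF \<kappa>, of "\<lambda>Y. (cmod (fourier (?h X) Y))\<^sup>2" 0] by simp
    then show ?case
      unfolding plancherel_norm[OF h1 elim] by (simp add: field_simps)
  qed
  have "integrable (lborel \<Otimes>\<^sub>M lborel) (\<lambda>(X, Y). (cmod (fourier_wigner \<kappa> f g X Y))\<^sup>2)"
  proof (rule lborel_pair.Fubini_integrable)
    have "integrable lborel (\<lambda>X. \<integral>Y. (cmod (fourier_wigner \<kappa> f g X Y))\<^sup>2 \<partial>lborel)"
    proof (subst integrable_cong_AE[OF _ _ eq])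
      show "integrable lborel (\<lambda>X. (2 * pi) ^ DIM('a) / \<bar>\<kappa>\<bar> ^ DIM('a)
          * (\<integral>U. (cmod (f U * cnj (g (U - X))))\<^sup>2 \<partial>lborel))"
        using integrable_norm_sq_mult_translate[OF f g] by (rule integrable_mult_right)
    qed measurable
    then show "integrable lborel (\<lambda>X. \<integral>Y. norm (case (X, Y) of (X, Y) \<Rightarrow> (cmod (fourier_wigner \<kappa> f g X Y))\<^sup>2) \<partial>lborel)"
      by simp
    show "AE X in lborel. integrable lborel (\<lambda>Y. case (X, Y) of (X, Y) \<Rightarrow> (cmod (fourier_wigner \<kappa> f g X Y))\<^sup>2)"
      using h2
    proof eventually_elim
      case (elim X)
      show ?case
        using square_integrableD[OF square_integrable_scale[OF square_integrable_fourier[OF h1 elim] \<kappa>]]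
        by (simp add: cmod_fourier_wigner)
    qed
  qed measurable
  then show ?thesis
    by (simp add: square_integrable_def case_prod_beta')
qed

text \<open>Plancherel contributes \<open>(2 * pi) ^ DIM('a)\<close>, and replacing \<kappa> Y by Y
  contributes the inverse power of \<open>\<bar>\<kappa>\<bar>\<close>. The unimodular phase is
  common to both transforms and cancels in the product.\<close>

theorem fourier_wigner_moyal:
  fixes f\<^sub>1 f\<^sub>2 g\<^sub>1 g\<^sub>2 :: "'a::euclidean_space \<Rightarrow> complex"
  assumes f: "square_integrable lborel f\<^sub>1" "square_integrable lborel f\<^sub>2"
    and g: "square_integrable lborel g\<^sub>1" "square_integrable lborel g\<^sub>2" and \<kappa>: "\<kappa> \<noteq> 0"
  shows "(\<integral>(X, Y). fourier_wigner \<kappa> f\<^sub>1 g\<^sub>1 X Y * cnj (fourier_wigner \<kappa> f\<^sub>2 g\<^sub>2 X Y) \<partial>(lborel \<Otimes>\<^sub>M lborel))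
    = complex_of_real ((2 * pi / \<bar>\<kappa>\<bar>) ^ DIM('a))
      * ((\<integral>U. f\<^sub>1 U * cnj (f\<^sub>2 U) \<partial>lborel) * cnj (\<integral>U. g\<^sub>1 U * cnj (g\<^sub>2 U) \<partial>lborel))"
proof -
  have [measurable]: "f\<^sub>1 \<in> borel_measurable borel" "f\<^sub>2 \<in> borel_measurable borel"
      "g\<^sub>1 \<in> borel_measurable borel" "g\<^sub>2 \<in> borel_measurable borel"
    using f g by (simp_all add: square_integrable_def)
  let ?h1 = "\<lambda>X U. f\<^sub>1 U * cnj (g\<^sub>1 (U - X))" and ?h2 = "\<lambda>X U. f\<^sub>2 U * cnj (g\<^sub>2 (U - X))"
  let ?V = "\<lambda>X Y. fourier_wigner \<kappa> f\<^sub>1 g\<^sub>1 X Y * cnj (fourier_wigner \<kappa> f\<^sub>2 g\<^sub>2 X Y)"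
  let ?C = "complex_of_real ((2 * pi / \<bar>\<kappa>\<bar>) ^ DIM('a))"
  have h1: "integrable lborel (?h1 X)" and h2: "integrable lborel (?h2 X)" for X
    by (rule square_integrable_mult_cnj[OF f(1) square_integrable_translate[OF g(1)]],
        rule square_integrable_mult_cnj[OF f(2) square_integrable_translate[OF g(2)]])
  have "integrable (lborel \<Otimes>\<^sub>M lborel) (\<lambda>(X, Y). ?V X Y)"
    using square_integrable_mult_cnj[OF square_integrable_fourier_wigner[OF f(1) g(1) \<kappa>]
        square_integrable_fourier_wigner[OF f(2) g(2) \<kappa>]] by (simp add: case_prod_beta')
  from lborel_pair.integral_fst'[OF this]
  have "(\<integral>(X, Y). ?V X Y \<partial>(lborel \<Otimes>\<^sub>M lborel)) = (\<integral>X. \<integral>Y. ?V X Y \<partial>lborel \<partial>lborel)"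
    by simp
  also have "\<dots> = (\<integral>X. ?C * (\<integral>U. ?h1 X U * cnj (?h2 X U) \<partial>lborel) \<partial>lborel)"
  proof (rule integral_cong_AE)
    show "AE X in lborel. (\<integral>Y. ?V X Y \<partial>lborel) = ?C * (\<integral>U. ?h1 X U * cnj (?h2 X U) \<partial>lborel)"
      using AE_square_integrable_mult_translate[OF f(1) g(1)] AE_square_integrable_mult_translate[OF f(2) g(2)]
    proof eventually_elim
      case (elim X)
      have "(\<integral>Y. ?V X Y \<partial>lborel)
        = inverse (\<bar>\<kappa>\<bar> ^ DIM('a)) *\<^sub>R (\<integral>Y. fourier (?h1 X) Y * cnj (fourier (?h2 X) Y) \<partial>lborel)"
        unfolding fourier_wigner_mult_cnj
        using integral_lborel_affine[OF \<kappa>, of "\<lambda>Y. fourier (?h1 X) Y * cnj (fourier (?h2 X) Y)" 0] by simp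
      then show ?case
        unfolding plancherel[OF h1 elim(1) h2 elim(2)]
        by (simp add: scaleR_conv_of_real divide_inverse power_mult_distrib power_inverse)
    qed
  qed measurable
  \<comment> \<open>Regrouped so that the signals depend on U alone and the windows on U - X alone.
    The windows enter conjugated, hence the conjugate of their inner product.\<close>
  also have "\<dots> = ?C * (\<integral>X. \<integral>U. (f\<^sub>1 U * cnj (f\<^sub>2 U)) * cnj (g\<^sub>1 (U - X) * cnj (g\<^sub>2 (U - X))) \<partial>lborel \<partial>lborel)"
    by (simp add: mult_ac)
  also have "(\<integral>X. \<integral>U. (f\<^sub>1 U * cnj (f\<^sub>2 U)) * cnj (g\<^sub>1 (U - X) * cnj (g\<^sub>2 (U - X))) \<partial>lborel \<partial>lborel)
    = (\<integral>U. f\<^sub>1 U * cnj (f\<^sub>2 U) \<partial>lborel) * (\<integral>U. cnj (g\<^sub>1 U * cnj (g\<^sub>2 U)) \<partial>lborel)"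
    using square_integrable_mult_cnj[OF g]
    by (intro integral_mult_diff square_integrable_mult_cnj[OF f]) (simp only: integrable_cnj)
  also have "(\<integral>U. cnj (g\<^sub>1 U * cnj (g\<^sub>2 U)) \<partial>lborel) = cnj (\<integral>U. g\<^sub>1 U * cnj (g\<^sub>2 U) \<partial>lborel)"
    by (rule Bochner_Integration.integral_cnj)
  finally show ?thesis .
qed

section \<open>Bicomplex-valued functions\<close>

text \<open>The two coordinates are ring homomorphisms onto the complex numbers and together
  injective, so bicomplex identities reduce to pairs of complex ones.\<close>

lemma idem_simps [simp]:
  "idem_plus (Z + W) = idem_plus Z + idem_plus W" "idem_minus (Z + W) = idem_minus Z + idem_minus W"
  "idem_plus (Z * W) = idem_plus Z * idem_plus W" "idem_minus (Z * W) = idem_minus Z * idem_minus W"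
  "idem_plus (r *\<^sub>R Z) = of_real r * idem_plus Z" "idem_minus (r *\<^sub>R Z) = of_real r * idem_minus Z"
  "idem_plus (- Z) = - idem_plus Z" "idem_minus (- Z) = - idem_minus Z"
  "idem_plus 1 = 1" "idem_minus 1 = 1"
  by (simp_all add: idem_plus_def idem_minus_def algebra_simps complex_eq_iff)

lemma idem_plus_of_idem [simp]: "idem_plus (of_idem a b) = a"
  and idem_minus_of_idem [simp]: "idem_minus (of_idem a b) = b"
  using idem_unique[of "of_idem a b" a b] by auto

lemma idem_eq_iff: "Z = W \<longleftrightarrow> idem_plus Z = idem_plus W \<and> idem_minus Z = idem_minus W"
  using idem_unique by metis

lemma idem_e_simps [simp]:
  "idem_plus e_plus = 1" "idem_minus e_plus = 0" "idem_plus e_minus = 0" "idem_minus e_minus = 1"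
  by (simp_all add: idem_plus_def idem_minus_def e_plus_def e_minus_def bc_i_def bc_j_def
      bc_of_complex_def complex_eq_iff)

lemma idem_conj_exp_simps [simp]:
  "idem_plus (bc_conj Z) = cnj (idem_plus Z)" "idem_minus (bc_conj Z) = cnj (idem_minus Z)"
  "idem_plus (bc_exp Z) = exp (idem_plus Z)" "idem_minus (bc_exp Z) = exp (idem_minus Z)"
  by (simp_all add: bc_conj_def bc_exp_def)

lemma idem_square_minus_one:
  assumes "\<nu>\<^sup>2 = -1"
  shows "(idem_plus \<nu>)\<^sup>2 = -1" "(idem_minus \<nu>)\<^sup>2 = -1"
proof -
  have "idem_plus (\<nu> * \<nu>) = idem_plus (-1)" "idem_minus (\<nu> * \<nu>) = idem_minus (-1)"
    using assms by (simp_all add: power2_eq_square)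
  then show "(idem_plus \<nu>)\<^sup>2 = -1" "(idem_minus \<nu>)\<^sup>2 = -1"
    unfolding idem_simps by (simp_all add: power2_eq_square)
qed

text \<open>\<open>of_idem\<close> is a sum of two bounded real-linear maps, one per component, and
  the Bochner integral commutes with each of them.\<close>

lemma integral_of_idem:
  assumes "integrable M f" "integrable M g"
  shows "(\<integral>x. of_idem (f x) (g x) \<partial>M) = of_idem (\<integral>x. f x \<partial>M) (\<integral>x. g x \<partial>M)"
proof -
  have l: "bounded_linear (\<lambda>a. of_idem a 0)" "bounded_linear (\<lambda>b. of_idem 0 b)"
    unfolding linear_conv_bounded_linear[symmetric]
    by (rule linearI; simp add: idem_eq_iff scaleR_conv_of_real[where 'a=complex])+
  have split: "of_idem a b = of_idem a 0 + of_idem 0 b" for a b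
    by (simp add: idem_eq_iff)
  have "(\<integral>x. of_idem (f x) 0 + of_idem 0 (g x) \<partial>M) = of_idem (\<integral>x. f x \<partial>M) 0 + of_idem 0 (\<integral>x. g x \<partial>M)"
    using assms by (simp add: integrable_bounded_linear[OF l(1)] integrable_bounded_linear[OF l(2)]
        integral_bounded_linear[OF l(1)] integral_bounded_linear[OF l(2)])
  then show ?thesis unfolding split[symmetric] .
qed

section \<open>Borel representatives of Lebesgue measurable functions\<close>

text \<open>The functions differ only inside a null set, all of whose subsets are measurable in the
  completion. This carries integrals between \<open>lebesgue\<close> and
  \<open>lborel\<close>.\<close>

lemma
  fixes f g :: "'a \<Rightarrow> 'b::{banach, second_countable_topology}"
  assumes f: "f \<in> borel_measurable M" and ae: "AE x in M. g x = f x"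
  shows measurable_completion_AE: "g \<in> borel_measurable (completion M)"
    and integral_completion_AE: "(\<integral>x. g x \<partial>completion M) = (\<integral>x. f x \<partial>M)"
    and integrable_completion_AE: "integrable (completion M) g \<longleftrightarrow> integrable M f"
proof -
  obtain N where N: "N \<in> null_sets M" "\<And>x. x \<in> space M \<Longrightarrow> g x \<noteq> f x \<Longrightarrow> x \<in> N"
    using ae unfolding eventually_ae_filter by auto
  show g: "g \<in> borel_measurable (completion M)"
  proof (rule measurableI)
    fix S :: "'b set" assume S: "S \<in> sets borel"
    show "g -` S \<inter> space (completion M) \<in> sets (completion M)"
    proof (rule sets_completionI)
      show "g -` S \<inter> space (completion M) = ((f -` S \<inter> space M) - N) \<union> (g -` S \<inter> space M \<inter> N)"
        using N(2) by (auto, metis)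
      show "(f -` S \<inter> space M) - N \<in> sets M"
        using measurable_sets[OF f S] N(1) by auto
    qed (use N(1) in auto)
  qed simp
  have ae': "AE x in completion M. g x = f x" by (rule AE_completion[OF ae])
  show "(\<integral>x. g x \<partial>completion M) = (\<integral>x. f x \<partial>M)"
    using integral_cong_AE[OF g measurable_completion[OF f] ae'] integral_completion[OF f] by simp
  show "integrable (completion M) g \<longleftrightarrow> integrable M f"
    using integrable_cong_AE[OF g measurable_completion[OF f] ae'] integrable_completion[OF f] by simp
qed

lemma L2C_borel_representative:
  assumes "f \<in> L2C"
  obtains g where "square_integrable lborel g" "AE x in lborel. f x = g x"
proof -
  have f: "f \<in> borel_measurable lebesgue" "integrable lebesgue (\<lambda>x. (cmod (f x))\<^sup>2)"
    using assms by (auto simp: L2C_def)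
  then have "(\<lambda>x. Re (f x)) \<in> borel_measurable lebesgue" "(\<lambda>x. Im (f x)) \<in> borel_measurable lebesgue"
    by simp_all
  then obtain a b where [measurable]: "a \<in> borel_measurable lborel" "b \<in> borel_measurable lborel"
    and a: "AE x in lborel. Re (f x) = a x" and b: "AE x in lborel. Im (f x) = b x"
    using completion_ex_borel_measurable_real by metis
  have eq: "AE x in lborel. f x = Complex (a x) (b x)"
    using a b by eventually_elim (simp add: complex_eq_iff)
  have [measurable]: "(\<lambda>x. Complex (a x) (b x)) \<in> borel_measurable lborel"
    unfolding Complex_eq by measurable
  have "AE x in lborel. (cmod (f x))\<^sup>2 = (cmod (Complex (a x) (b x)))\<^sup>2"
    using eq by eventually_elim simp
  then have "integrable lborel (\<lambda>x. (cmod (Complex (a x) (b x)))\<^sup>2)"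
    using integrable_completion_AE[of "\<lambda>x. (cmod (Complex (a x) (b x)))\<^sup>2" lborel "\<lambda>x. (cmod (f x))\<^sup>2"] f(2)
    by simp
  then have "square_integrable lborel (\<lambda>x. Complex (a x) (b x))"
    by (simp add: square_integrable_def)
  with eq show thesis by (rule that[rotated])
qed

section \<open>Lebesgue measure on the bicomplex numbers as a product measure\<close>

text \<open>The coordinate permutation taking (x1, x2, y1, y2) to (x1, y1, x2, y2): a right inverse
  of the map Z to \<open>(bc_X Z, bc_Y Z)\<close>.\<close>

definition bc_of_real4 :: "(real^2) \<times> (real^2) \<Rightarrow> bicomplex" where
  "bc_of_real4 p = Bicomplex (Complex (fst p $ 1) (snd p $ 1)) (Complex (fst p $ 2) (snd p $ 2))"

lemma bc_X_of_real4 [simp]: "bc_X (bc_of_real4 p) = fst p"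
  and bc_Y_of_real4 [simp]: "bc_Y (bc_of_real4 p) = snd p"
  by (simp_all add: bc_X_def bc_Y_def bc_of_real4_def vec_eq_iff forall_2)

lemma bc_X_measurable [measurable]: "bc_X \<in> borel_measurable borel"
  and bc_Y_measurable [measurable]: "bc_Y \<in> borel_measurable borel"
proof -
  have "linear bc_X" "linear bc_Y"
    by (rule linearI; simp add: bc_X_def bc_Y_def vec_eq_iff forall_2)+
  then show "bc_X \<in> borel_measurable borel" "bc_Y \<in> borel_measurable borel"
    by (auto intro!: borel_measurable_continuous_onI linear_continuous_on simp: linear_conv_bounded_linear)
qed

lemma bc_of_real4_measurable [measurable]: "bc_of_real4 \<in> borel_measurable borel"
proof -
  have "linear bc_of_real4"
    by (rule linearI) (simp_all add: bc_of_real4_def bicomplex_eq_iff complex_eq_iff)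
  then show ?thesis
    by (auto intro!: borel_measurable_continuous_onI linear_continuous_on simp: linear_conv_bounded_linear)
qed

lemma prod_Basis_real2: "(\<Prod>b\<in>Basis. (x :: real^2) \<bullet> b) = x $ 1 * x $ 2"
proof -
  have B: "(Basis :: (real^2) set) = {axis 1 1, axis 2 1}"
    by (auto simp: Basis_vec_def UNIV_2)
  have "axis 1 1 \<noteq> (axis 2 1 :: real^2)" by (simp add: axis_eq_axis)
  then show ?thesis unfolding B by (simp add: inner_axis)
qed

text \<open>Lebesgue measure is determined by its values on boxes. Permuting coordinates makes the
  preimage of a box a product of a box in X and a box in Y, with the same four side lengths.
  Integrals over Z thus become integrals over (X, Y).\<close>

lemma lborel_bicomplex: "(lborel :: bicomplex measure) = distr (lborel \<Otimes>\<^sub>M lborel) borel bc_of_real4"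
proof (rule lborel_eqI)
  have [measurable]: "bc_of_real4 \<in> borel_measurable (lborel \<Otimes>\<^sub>M lborel)"
    using bc_of_real4_measurable by (simp add: lborel_prod)
  fix l u :: bicomplex
  assume le: "\<And>b. b \<in> Basis \<Longrightarrow> l \<bullet> b \<le> u \<bullet> b"
  have in_box: "Z \<in> box l u \<longleftrightarrow> bc_X Z \<in> box (bc_X l) (bc_X u) \<and> bc_Y Z \<in> box (bc_Y l) (bc_Y u)" for Z
    by (auto simp: mem_box[where 'a=bicomplex] Basis_bicomplex_def inner_bicomplex_def inner_complex_def mem_box_cart
        bc_X_def bc_Y_def forall_2)
  have le': "\<forall>b\<in>Basis. bc_X l \<bullet> b \<le> bc_X u \<bullet> b" "\<forall>b\<in>Basis. bc_Y l \<bullet> b \<le> bc_Y u \<bullet> b"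
    using le[of "Bicomplex 1 0"] le[of "Bicomplex \<i> 0"] le[of "Bicomplex 0 1"] le[of "Bicomplex 0 \<i>"]
    by (auto simp: Basis_bicomplex_def inner_bicomplex_def inner_complex_def
        bc_X_def bc_Y_def Basis_vec_def UNIV_2 inner_axis)
  have "bc_of_real4 -` box l u = box (bc_X l) (bc_X u) \<times> box (bc_Y l) (bc_Y u)"
    using in_box[of "bc_of_real4 p" for p] by auto
  then have "emeasure (distr (lborel \<Otimes>\<^sub>M lborel) borel bc_of_real4) (box l u)
    = emeasure lborel (box (bc_X l) (bc_X u)) * emeasure lborel (box (bc_Y l) (bc_Y u))"
    by (simp add: emeasure_distr space_pair_measure lborel.emeasure_pair_measure_Times)
  also have "\<dots> = ennreal ((\<Prod>b\<in>Basis. (bc_X u - bc_X l) \<bullet> b) * (\<Prod>b\<in>Basis. (bc_Y u - bc_Y l) \<bullet> b))"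
    using le' by (simp add: emeasure_lborel_box_eq ennreal_mult' prod_nonneg inner_diff_left)
  also have "(\<Prod>b\<in>Basis. (bc_X u - bc_X l) \<bullet> b) * (\<Prod>b\<in>Basis. (bc_Y u - bc_Y l) \<bullet> b) = (\<Prod>b\<in>Basis. (u - l) \<bullet> b)"
    unfolding prod_Basis_real2
    by (simp add: Basis_bicomplex_def inner_bicomplex_def inner_complex_def bc_X_def bc_Y_def)
  finally show "emeasure (distr (lborel \<Otimes>\<^sub>M lborel) borel bc_of_real4) (box l u) = (\<Prod>b\<in>Basis. (u - l) \<bullet> b)" .
qed simp


section \<open>Transfer to the complex and bicomplex transforms\<close>

lemma square_integrable_completion: "square_integrable M f \<Longrightarrow> square_integrable (completion M) f"
  by (auto simp: square_integrable_def integrable_completion intro!: measurable_completion)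

lemma L2C_iff: "f \<in> L2C \<longleftrightarrow> square_integrable lebesgue f"
  by (simp add: L2C_def square_integrable_def)

lemma idem_L2T:
  assumes "\<phi> \<in> L2T"
  shows "(\<lambda>x. idem_plus (\<phi> x)) \<in> L2C" "(\<lambda>x. idem_minus (\<phi> x)) \<in> L2C"
  using assms by (simp_all add: L2T_def)

lemma L2T_inner_eq:
  assumes "f \<in> L2T" "g \<in> L2T"
  shows "L2T_inner f g = of_idem (\<integral>x. idem_plus (f x) * cnj (idem_plus (g x)) \<partial>lebesgue)
    (\<integral>x. idem_minus (f x) * cnj (idem_minus (g x)) \<partial>lebesgue)"
proof -
  have "f x * bc_conj (g x) = of_idem (idem_plus (f x) * cnj (idem_plus (g x))) (idem_minus (f x) * cnj (idem_minus (g x)))" for x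
    by (simp add: idem_eq_iff)
  then show ?thesis
    unfolding L2T_inner_def using idem_L2T[OF assms(1)] idem_L2T[OF assms(2)]
    by (simp add: integral_of_idem square_integrable_mult_cnj L2C_iff)
qed

lemma AE_lborel_translate:
  assumes "AE x in lborel. P x"
  shows "AE x in lborel. P (x - t :: 'a::euclidean_space)"
proof -
  have "AE x in distr lborel borel ((+) (- t)). P x"
    unfolding lborel_distr_plus by (rule assms)
  from AE_distrD[OF _ this] show ?thesis by simp
qed

text \<open>The integral over U ignores null sets, and these stay null under the translation by X in
  the window. Passing to Borel representatives therefore preserves the transform at every X and Y,
  not merely almost everywhere.\<close>

lemma
  assumes f: "square_integrable lborel f'" "AE U in lborel. f U = f' U"
    and g: "square_integrable lborel g'" "AE U in lborel. g U = g' U"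
    and \<tau>: "\<And>r. exp (\<tau> * of_real r) = cis (s * r)"
  shows integrable_fourier_wigner_C_borel:
      "integrable lebesgue (\<lambda>U. exp (\<tau> * of_real (\<sigma> * ((U - X /\<^sub>R 2) \<bullet> Y))) * f U * cnj (g (U - X)))"
    and fourier_wigner_C_borel:
      "fourier_wigner_C \<sigma> \<tau> f g X Y = of_real (\<sigma> / (2 * pi)) * fourier_wigner (s * \<sigma>) f' g' X Y"
proof -
  have [measurable]: "f' \<in> borel_measurable borel" "g' \<in> borel_measurable borel"
    using f g by (simp_all add: square_integrable_def)
  let ?h = "\<lambda>U. cis (s * \<sigma> * ((U - X /\<^sub>R 2) \<bullet> Y)) * f' U * cnj (g' (U - X))"
  have ae: "AE U in lborel. exp (\<tau> * of_real (\<sigma> * ((U - X /\<^sub>R 2) \<bullet> Y))) * f U * cnj (g (U - X)) = ?h U"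
    using f(2) AE_lborel_translate[OF g(2), of X] by eventually_elim (simp only: \<tau> mult.assoc)
  have m: "?h \<in> borel_measurable lborel" by measurable
  have "integrable lborel ?h"
    using integrable_cis_mult[OF square_integrable_mult_cnj[OF f(1) square_integrable_translate[OF g(1), of X]],
        of "\<lambda>U. s * \<sigma> * ((U - X /\<^sub>R 2) \<bullet> Y)"] by (simp add: mult.assoc)
  then show "integrable lebesgue (\<lambda>U. exp (\<tau> * of_real (\<sigma> * ((U - X /\<^sub>R 2) \<bullet> Y))) * f U * cnj (g (U - X)))"
    by (simp only: integrable_completion_AE[OF m ae])
  show "fourier_wigner_C \<sigma> \<tau> f g X Y = of_real (\<sigma> / (2 * pi)) * fourier_wigner (s * \<sigma>) f' g' X Y"
    unfolding fourier_wigner_C_def fourier_wigner_def integral_completion_AE[OF m ae] ..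
qed

text \<open>The only square roots of -1 in the complex numbers are \<i> and -\<i>; \<open>s\<close>
  is the sign with \<tau> = s \<i>.\<close>

lemma exp_imaginary_unit:
  assumes "\<tau>\<^sup>2 = -1"
  obtains s where "\<bar>s\<bar> = 1" "\<And>r. exp (\<tau> * of_real r) = cis (s * r)"
proof -
  have "\<tau>\<^sup>2 = \<i>\<^sup>2" using assms by simp
  then consider "\<tau> = \<i>" | "\<tau> = - \<i>" by (auto simp only: power2_eq_iff)
  then show thesis
  proof cases
    case 1 then show ?thesis by (intro that[of 1]) (simp_all add: cis_conv_exp)
  next
    case 2 then show ?thesis by (intro that[of "-1"]) (simp_all add: cis_conv_exp)
  qed
qed

lemma integrable_fourier_wigner_C:
  fixes f g :: "real^2 \<Rightarrow> complex"
  assumes "f \<in> L2C" "g \<in> L2C" "\<tau>\<^sup>2 = -1"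
  shows "integrable lebesgue (\<lambda>U. exp (\<tau> * of_real (\<sigma> * ((U - X /\<^sub>R 2) \<bullet> Y))) * f U * cnj (g (U - X)))"
proof -
  obtain f' where f: "square_integrable lborel f'" "AE U in lborel. f U = f' U"
    using L2C_borel_representative[OF assms(1)] .
  obtain g' where g: "square_integrable lborel g'" "AE U in lborel. g U = g' U"
    using L2C_borel_representative[OF assms(2)] .
  obtain s where "\<And>r. exp (\<tau> * of_real r) = cis (s * r)"
    using exp_imaginary_unit[OF assms(3)] by metis
  from integrable_fourier_wigner_C_borel[OF f g this] show ?thesis .
qed

text \<open>Moyal's identity for Borel representatives is carried over to \<open>lebesgue\<close> on
  the bicomplex numbers. On \<open>real^2\<close> the exponent is 2, so the prefactors cancel its
  constant.\<close>

lemma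
  assumes f: "f\<^sub>1 \<in> L2C" "f\<^sub>2 \<in> L2C" and g: "g\<^sub>1 \<in> L2C" "g\<^sub>2 \<in> L2C"
    and \<sigma>: "\<sigma> > 0" and \<tau>: "\<tau>\<^sup>2 = -1"
  shows fourier_wigner_C_L2C: "(\<lambda>Z. fourier_wigner_C \<sigma> \<tau> f\<^sub>1 g\<^sub>1 (bc_X Z) (bc_Y Z)) \<in> L2C"
    and fourier_wigner_C_moyal:
      "(\<integral>Z. fourier_wigner_C \<sigma> \<tau> f\<^sub>1 g\<^sub>1 (bc_X Z) (bc_Y Z)
          * cnj (fourier_wigner_C \<sigma> \<tau> f\<^sub>2 g\<^sub>2 (bc_X Z) (bc_Y Z)) \<partial>lebesgue)
        = (\<integral>U. f\<^sub>1 U * cnj (f\<^sub>2 U) \<partial>lebesgue) * cnj (\<integral>U. g\<^sub>1 U * cnj (g\<^sub>2 U) \<partial>lebesgue)"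
proof -
  obtain F\<^sub>1 where F\<^sub>1: "square_integrable lborel F\<^sub>1" "AE U in lborel. f\<^sub>1 U = F\<^sub>1 U"
    using L2C_borel_representative[OF f(1)] .
  obtain F\<^sub>2 where F\<^sub>2: "square_integrable lborel F\<^sub>2" "AE U in lborel. f\<^sub>2 U = F\<^sub>2 U"
    using L2C_borel_representative[OF f(2)] .
  obtain G\<^sub>1 where G\<^sub>1: "square_integrable lborel G\<^sub>1" "AE U in lborel. g\<^sub>1 U = G\<^sub>1 U"
    using L2C_borel_representative[OF g(1)] .
  obtain G\<^sub>2 where G\<^sub>2: "square_integrable lborel G\<^sub>2" "AE U in lborel. g\<^sub>2 U = G\<^sub>2 U"
    using L2C_borel_representative[OF g(2)] .
  obtain s where s: "\<bar>s\<bar> = 1" "\<And>r. exp (\<tau> * of_real r) = cis (s * r)"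
    using exp_imaginary_unit[OF \<tau>] by metis
  have [measurable]: "F\<^sub>1 \<in> borel_measurable borel" "F\<^sub>2 \<in> borel_measurable borel"
    "G\<^sub>1 \<in> borel_measurable borel" "G\<^sub>2 \<in> borel_measurable borel"
    using F\<^sub>1 F\<^sub>2 G\<^sub>1 G\<^sub>2 by (simp_all add: square_integrable_def)
  \<comment> \<open>The sign of the imaginary unit is absorbed into the frequency; only
    \<open>\<bar>\<kappa>\<bar> = \<sigma>\<close> survives in the constant.\<close>
  define \<kappa> where "\<kappa> = s * \<sigma>"
  have \<kappa>: "\<kappa> \<noteq> 0" "\<bar>\<kappa>\<bar> = \<sigma>" using s(1) \<sigma> by (auto simp: \<kappa>_def abs_mult)
  let ?V = "\<lambda>F G Z. fourier_wigner \<kappa> F G (bc_X Z) (bc_Y Z)"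
  have V: "fourier_wigner_C \<sigma> \<tau> f\<^sub>1 g\<^sub>1 X Y = of_real (\<sigma> / (2 * pi)) * fourier_wigner \<kappa> F\<^sub>1 G\<^sub>1 X Y"
    "fourier_wigner_C \<sigma> \<tau> f\<^sub>2 g\<^sub>2 X Y = of_real (\<sigma> / (2 * pi)) * fourier_wigner \<kappa> F\<^sub>2 G\<^sub>2 X Y" for X Y
    unfolding \<kappa>_def using fourier_wigner_C_borel[OF F\<^sub>1 G\<^sub>1 s(2)] fourier_wigner_C_borel[OF F\<^sub>2 G\<^sub>2 s(2)] by blast+
  have meas: "?V F G \<in> borel_measurable borel"
    if [measurable]: "F \<in> borel_measurable borel" "G \<in> borel_measurable borel" for F G
    using measurable_compose[of "\<lambda>Z. (bc_X Z, bc_Y Z)", OF _ fourier_wigner_measurable[of F G \<kappa>]] by simp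
  note [measurable] = meas[of F\<^sub>1 G\<^sub>1] meas[of F\<^sub>2 G\<^sub>2]
  have mk: "bc_of_real4 \<in> measurable (lborel \<Otimes>\<^sub>M lborel) borel"
    using bc_of_real4_measurable by (simp add: lborel_prod)
  have sq: "square_integrable lborel (?V F\<^sub>1 G\<^sub>1)"
    using square_integrable_fourier_wigner[OF F\<^sub>1(1) G\<^sub>1(1) \<kappa>(1)] meas[of F\<^sub>1 G\<^sub>1]
    by (simp add: square_integrable_def lborel_bicomplex integrable_distr_eq[OF mk] case_prod_beta')
  show "(\<lambda>Z. fourier_wigner_C \<sigma> \<tau> f\<^sub>1 g\<^sub>1 (bc_X Z) (bc_Y Z)) \<in> L2C"
  proof -
    have "square_integrable lborel (\<lambda>Z. c * ?V F\<^sub>1 G\<^sub>1 Z)" for c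
      using sq by (auto simp: square_integrable_def norm_mult power_mult_distrib)
    then show ?thesis
      unfolding V L2C_iff by (rule square_integrable_completion)
  qed
  have "(\<integral>Z. fourier_wigner_C \<sigma> \<tau> f\<^sub>1 g\<^sub>1 (bc_X Z) (bc_Y Z)
          * cnj (fourier_wigner_C \<sigma> \<tau> f\<^sub>2 g\<^sub>2 (bc_X Z) (bc_Y Z)) \<partial>lebesgue)
    = (\<integral>Z. of_real ((\<sigma> / (2 * pi))\<^sup>2) * (?V F\<^sub>1 G\<^sub>1 Z * cnj (?V F\<^sub>2 G\<^sub>2 Z)) \<partial>lborel)"
    unfolding V by (subst integral_completion) (simp_all add: power2_eq_square mult_ac)
  also have "\<dots> = of_real ((\<sigma> / (2 * pi))\<^sup>2) * (\<integral>Z. ?V F\<^sub>1 G\<^sub>1 Z * cnj (?V F\<^sub>2 G\<^sub>2 Z) \<partial>lborel)"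
    by (rule integral_mult_right_zero)
  also have "(\<integral>Z. ?V F\<^sub>1 G\<^sub>1 Z * cnj (?V F\<^sub>2 G\<^sub>2 Z) \<partial>lborel)
    = (\<integral>(X, Y). fourier_wigner \<kappa> F\<^sub>1 G\<^sub>1 X Y * cnj (fourier_wigner \<kappa> F\<^sub>2 G\<^sub>2 X Y) \<partial>(lborel \<Otimes>\<^sub>M lborel))"
    unfolding lborel_bicomplex by (subst integral_distr[OF mk]) (simp_all add: case_prod_beta')
  also have "\<dots> = complex_of_real ((2 * pi / \<sigma>)\<^sup>2)
      * ((\<integral>U. F\<^sub>1 U * cnj (F\<^sub>2 U) \<partial>lborel) * cnj (\<integral>U. G\<^sub>1 U * cnj (G\<^sub>2 U) \<partial>lborel))"
    using fourier_wigner_moyal[OF F\<^sub>1(1) F\<^sub>2(1) G\<^sub>1(1) G\<^sub>2(1) \<kappa>(1)] \<kappa>(2) by simp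
  also have "of_real ((\<sigma> / (2 * pi))\<^sup>2) * (complex_of_real ((2 * pi / \<sigma>)\<^sup>2) * z) = z" for z
  proof -
    have "(\<sigma> / (2 * pi))\<^sup>2 * (2 * pi / \<sigma>)\<^sup>2 = 1"
      using \<sigma> by (simp flip: power_mult_distrib)
    then have "complex_of_real ((\<sigma> / (2 * pi))\<^sup>2) * complex_of_real ((2 * pi / \<sigma>)\<^sup>2) = 1"
      by (metis of_real_1 of_real_mult)
    then show ?thesis by (metis mult.assoc mult_1)
  qed
  also have "(\<integral>U. F\<^sub>1 U * cnj (F\<^sub>2 U) \<partial>lborel) = (\<integral>U. f\<^sub>1 U * cnj (f\<^sub>2 U) \<partial>lebesgue)"
  proof (rule integral_completion_AE[symmetric])
    show "AE U in lborel. f\<^sub>1 U * cnj (f\<^sub>2 U) = F\<^sub>1 U * cnj (F\<^sub>2 U)"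
      using F\<^sub>1(2) F\<^sub>2(2) by eventually_elim simp
  qed measurable
  also have "(\<integral>U. G\<^sub>1 U * cnj (G\<^sub>2 U) \<partial>lborel) = (\<integral>U. g\<^sub>1 U * cnj (g\<^sub>2 U) \<partial>lebesgue)"
  proof (rule integral_completion_AE[symmetric])
    show "AE U in lborel. g\<^sub>1 U * cnj (g\<^sub>2 U) = G\<^sub>1 U * cnj (G\<^sub>2 U)"
      using G\<^sub>1(2) G\<^sub>2(2) by eventually_elim simp
  qed measurable
  finally show "(\<integral>Z. fourier_wigner_C \<sigma> \<tau> f\<^sub>1 g\<^sub>1 (bc_X Z) (bc_Y Z)
          * cnj (fourier_wigner_C \<sigma> \<tau> f\<^sub>2 g\<^sub>2 (bc_X Z) (bc_Y Z)) \<partial>lebesgue)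
        = (\<integral>U. f\<^sub>1 U * cnj (f\<^sub>2 U) \<partial>lebesgue) * cnj (\<integral>U. g\<^sub>1 U * cnj (g\<^sub>2 U) \<partial>lebesgue)" .
qed

text \<open>The exponent \<nu> \<open>e_plus\<close> + \<mu> \<open>e_minus\<close> has the
  coordinates \<open>idem_plus \<nu>\<close> and \<open>idem_minus \<mu>\<close>, so each component
  sees its own imaginary unit. Integrability of both components permits integrating them
  separately.\<close>

lemma fourier_wigner_T_eq:
  assumes \<phi>: "\<phi> \<in> L2T" and \<psi>: "\<psi> \<in> L2T" and units: "\<nu>\<^sup>2 = -1" "\<mu>\<^sup>2 = -1"
  shows "fourier_wigner_T \<sigma> \<nu> \<mu> \<phi> \<psi> Z = of_idem
    (fourier_wigner_C \<sigma> (idem_plus \<nu>) (\<lambda>U. idem_plus (\<phi> U)) (\<lambda>U. idem_plus (\<psi> U)) (bc_X Z) (bc_Y Z))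
    (fourier_wigner_C \<sigma> (idem_minus \<mu>) (\<lambda>U. idem_minus (\<phi> U)) (\<lambda>U. idem_minus (\<psi> U)) (bc_X Z) (bc_Y Z))"
proof -
  let ?r = "\<lambda>U. \<sigma> * ((U - bc_X Z /\<^sub>R 2) \<bullet> bc_Y Z)"
  have split: "bc_exp (r *\<^sub>R (\<nu> * e_plus + \<mu> * e_minus)) * a * bc_conj b = of_idem
      (exp (idem_plus \<nu> * of_real r) * idem_plus a * cnj (idem_plus b))
      (exp (idem_minus \<mu> * of_real r) * idem_minus a * cnj (idem_minus b))" for r a b
    by (simp add: idem_eq_iff mult.commute[of "of_real r"])
  have "(\<integral>U. bc_exp (?r U *\<^sub>R (\<nu> * e_plus + \<mu> * e_minus)) * \<phi> U * bc_conj (\<psi> (U - bc_X Z)) \<partial>lebesgue)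
    = of_idem
      (\<integral>U. exp (idem_plus \<nu> * of_real (?r U)) * idem_plus (\<phi> U) * cnj (idem_plus (\<psi> (U - bc_X Z))) \<partial>lebesgue)
      (\<integral>U. exp (idem_minus \<mu> * of_real (?r U)) * idem_minus (\<phi> U) * cnj (idem_minus (\<psi> (U - bc_X Z))) \<partial>lebesgue)"
    unfolding split
    by (intro integral_of_idem
        integrable_fourier_wigner_C[OF idem_L2T(1)[OF \<phi>] idem_L2T(1)[OF \<psi>] idem_square_minus_one(1)[OF units(1)]]
        integrable_fourier_wigner_C[OF idem_L2T(2)[OF \<phi>] idem_L2T(2)[OF \<psi>] idem_square_minus_one(2)[OF units(2)]])
  then show ?thesis
    unfolding fourier_wigner_T_def fourier_wigner_C_def by (simp add: idem_eq_iff)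
qed

text \<open>The window factor carries \<open>bc_conj\<close> because the transform is
  conjugate-linear in its window: the left side is conjugate-linear in the first window, whereas
  \<open>L2T_inner\<close> is linear in its first argument. Membership in \<open>L2T\<close> makes
  the inner product on the left meaningful, since the Bochner integral of a non-integrable function
  is 0 by convention.\<close>

theorem lemma4p2:
  fixes \<sigma> :: real and \<nu> \<mu> :: bicomplex
  assumes "\<sigma> > 0" and "\<nu>\<^sup>2 = -1" and "\<mu>\<^sup>2 = -1"
  shows "(\<forall>\<phi>\<in>L2T. \<forall>\<psi>\<in>L2T. \<forall>Z.
            fourier_wigner_T \<sigma> \<nu> \<mu> \<phi> \<psi> Z =
              bc_of_complex (fourier_wigner_C \<sigma> (idem_plus \<nu>)
                (\<lambda>U. idem_plus (\<phi> U)) (\<lambda>U. idem_plus (\<psi> U)) (bc_X Z) (bc_Y Z)) * e_plus +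
              bc_of_complex (fourier_wigner_C \<sigma> (idem_minus \<mu>)
                (\<lambda>U. idem_minus (\<phi> U)) (\<lambda>U. idem_minus (\<psi> U)) (bc_X Z) (bc_Y Z)) * e_minus)
       \<and> (\<forall>\<phi>\<in>L2T. \<forall>\<psi>\<in>L2T. fourier_wigner_T \<sigma> \<nu> \<mu> \<phi> \<psi> \<in> L2T)
       \<and> (\<forall>\<phi>\<^sub>1\<in>L2T. \<forall>\<phi>\<^sub>2\<in>L2T. \<forall>\<psi>\<^sub>1\<in>L2T. \<forall>\<psi>\<^sub>2\<in>L2T.
            L2T_inner (fourier_wigner_T \<sigma> \<nu> \<mu> \<phi>\<^sub>1 \<psi>\<^sub>1) (fourier_wigner_T \<sigma> \<nu> \<mu> \<phi>\<^sub>2 \<psi>\<^sub>2) =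
              L2T_inner \<phi>\<^sub>1 \<phi>\<^sub>2 * bc_conj (L2T_inner \<psi>\<^sub>1 \<psi>\<^sub>2))"
proof (intro conjI ballI allI)
  note units = idem_square_minus_one(1)[OF assms(2)] idem_square_minus_one(2)[OF assms(3)]
  show L2T: "fourier_wigner_T \<sigma> \<nu> \<mu> \<phi> \<psi> \<in> L2T" if "\<phi> \<in> L2T" "\<psi> \<in> L2T" for \<phi> \<psi>
    unfolding L2T_def fourier_wigner_T_eq[OF that assms(2,3)]
    using fourier_wigner_C_L2C[OF idem_L2T(1)[OF that(1)] idem_L2T(1)[OF that(1)]
        idem_L2T(1)[OF that(2)] idem_L2T(1)[OF that(2)] assms(1) units(1)]
      fourier_wigner_C_L2C[OF idem_L2T(2)[OF that(1)] idem_L2T(2)[OF that(1)]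
        idem_L2T(2)[OF that(2)] idem_L2T(2)[OF that(2)] assms(1) units(2)]
    by (simp add: fourier_wigner_T_eq[OF that assms(2,3)])
  fix \<phi>\<^sub>1 \<phi>\<^sub>2 \<psi>\<^sub>1 \<psi>\<^sub>2 :: "real^2 \<Rightarrow> bicomplex"
  assume L: "\<phi>\<^sub>1 \<in> L2T" "\<phi>\<^sub>2 \<in> L2T" "\<psi>\<^sub>1 \<in> L2T" "\<psi>\<^sub>2 \<in> L2T"
  show "L2T_inner (fourier_wigner_T \<sigma> \<nu> \<mu> \<phi>\<^sub>1 \<psi>\<^sub>1) (fourier_wigner_T \<sigma> \<nu> \<mu> \<phi>\<^sub>2 \<psi>\<^sub>2) =
              L2T_inner \<phi>\<^sub>1 \<phi>\<^sub>2 * bc_conj (L2T_inner \<psi>\<^sub>1 \<psi>\<^sub>2)"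
    unfolding L2T_inner_eq[OF L2T[OF L(1,3)] L2T[OF L(2,4)]] L2T_inner_eq[OF L(1,2)] L2T_inner_eq[OF L(3,4)]
      fourier_wigner_T_eq[OF L(1,3) assms(2,3)] fourier_wigner_T_eq[OF L(2,4) assms(2,3)]
      idem_plus_of_idem idem_minus_of_idem
      fourier_wigner_C_moyal[OF L[THEN idem_L2T(1)] assms(1) units(1)]
      fourier_wigner_C_moyal[OF L[THEN idem_L2T(2)] assms(1) units(2)]
    by (simp add: idem_eq_iff)
qed (simp add: fourier_wigner_T_eq[OF _ _ assms(2,3)] of_idem_def)

end
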